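(* Let $k\ge 5$ be an integer and let $G$ be a graph with $n\ge 2k+3$ vertices. If the minimum degree satisfies $\delta(G)\ge \frac{n+k}{2}-1$, then $G$ is $k$-knitted. Moreover, the minimum degree condition is sharp: for every $k\ge 5$ and every $n\ge 2k+3$ there exists a graph on $n$ vertices with minimum degree $\left\lfloor \frac{n+k}{2}\right\rfloor-2$ that is not $k$-knitted.
   Context: All graphs are finite and simple. For a positive integer $k$, a graph $G$ with at least $k$ vertices is $k$-knitted if for every set $S\subseteq V(G)$ with $|S|=k$, every integer $t\ge 1$, and every partition of $S$ into $t$ non-empty parts $S_1,\ldots,S_t$, the graph $G$ contains pairwise vertex-disjoint connected subgraphs $C_1,\ldots,C_t$ with $S_i\subseteq V(C_i)$ for each $i\in\{1,\ldots,t\}$. $\delta(G)$ denotes the minimum degree of $G$. *)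

theory Defs
  imports
    Complex_Main
    "HOL-Library.Disjoint_Sets"
    "Graph_Theory.Digraph_Component"
begin

(* A finite simple undirected graph is a pair_graph: a finite, loop-free, symmetric arc relation
   on the vertex set.  Each edge uv is represented by both arcs (u,v) and (v,u), so the degree of
   a vertex is its out_degree. *)

(* Meaningful only for graphs with at least one vertex. *)
definition min_degree :: "'a pair_pre_digraph \<Rightarrow> nat" where
  "min_degree G = Min (out_degree (with_proj G) ` pverts G)"

(* The subgraphs C i need not be induced.  The qualified name avoids the topological constant
   of the same name. *)
definition knitted :: "nat \<Rightarrow> 'a pair_pre_digraph \<Rightarrow> bool" where
  "knitted k G \<longleftrightarrow>
     k \<le> card (pverts G) \<and>
     (\<forall>S t P.
        S \<subseteq> pverts G \<and> card S = k \<and> t \<ge> (1::nat) \<and>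
        (\<Union>i\<in>{1..t}. P i) = S \<and> disjoint_family_on P {1..t} \<and> (\<forall>i\<in>{1..t}. P i \<noteq> {}) \<longrightarrow>
        (\<exists>C :: nat \<Rightarrow> 'a pair_pre_digraph.
           (\<forall>i\<in>{1..t}. pair_graph (C i) \<and> subgraph (with_proj (C i)) (with_proj G) \<and>
              Digraph_Component.connected (with_proj (C i)) \<and> P i \<subseteq> pverts (C i)) \<and>
           disjoint_family_on (\<lambda>i. pverts (C i)) {1..t}))"

end

theory Submission
  imports Defs
begin

text \<open>
  Write \<open>W = V - S\<close>. The degree condition survives as local inequalities: a vertex of \<open>S\<close> has more
  than half of \<open>W\<close> as neighbours, with a surplus for every non-neighbour in \<open>S\<close>, and a vertex of \<open>W\<close>
  misses at most \<open>|W| / 2\<close> vertices of \<open>S\<close>.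

  First, distribute vertices of \<open>W\<close> over the parts so that the number of distributed vertices plus
  twice the number of remaining components is minimal, where only edges meeting \<open>S\<close> count. If some
  part had three components, then many vertices of \<open>W\<close> would join two of them; none of these may be
  free, and replacing one in its present part by a free vertex \<open>d\<close> must not work, which forces \<open>d\<close>
  to miss more than \<open>|W| / 2\<close> vertices of \<open>S\<close>. So every part has at most two components and few
  vertices of \<open>W\<close> are used.

  Second, among all systems of disjoint connected blocks covering \<open>S\<close> that use so few vertices, take
  one with the fewest blocks and then the fewest vertices. If two blocks \<open>X\<close>, \<open>Y\<close> belong to the same
  part, exchanging single vertices provides \<open>x \<in> X\<close>, \<open>y \<in> Y\<close> with free neighbours \<open>a\<close>, \<open>b\<close>. No
  path with at most two free inner vertices joins \<open>X\<close> to \<open>Y\<close>, not even after exchanging \<open>a\<close> or \<open>b\<close>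
  with a vertex of another block, and this makes the degree sum of \<open>x, y, a, b\<close> too small.
\<close>

section \<open>Connected vertex sets and local degree bounds\<close>

text \<open>Connectedness by cuts instead of paths: merging, exchanging and pruning blocks then
  reduce to asking which edge leaves a given subset.\<close>

definition conn :: "('a \<Rightarrow> 'a \<Rightarrow> bool) \<Rightarrow> 'a set \<Rightarrow> bool" where
  "conn E X \<longleftrightarrow> X \<noteq> {} \<and> (\<forall>Q\<subseteq>X. Q \<noteq> {} \<and> Q \<noteq> X \<longrightarrow> (\<exists>q\<in>Q. \<exists>r\<in>X - Q. E q r))"

definition deg :: "('a \<Rightarrow> 'a \<Rightarrow> bool) \<Rightarrow> 'a \<Rightarrow> 'a set \<Rightarrow> nat" where
  "deg E v T = card {u \<in> T. E v u}"

lemma connE: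
  assumes "conn E X" "Q \<subseteq> X" "Q \<noteq> {}" "Q \<noteq> X"
  obtains q r where "q \<in> Q" "r \<in> X - Q" "E q r"
  using assms unfolding conn_def by blast

lemma conn_singleton: "conn E {v}"
  unfolding conn_def by auto

text \<open>A cut \<open>Q\<close> either splits \<open>X\<close> or \<open>Y\<close>, where an edge
  exists by hypothesis, or it separates the two sets and the edge from \<open>x\<close> to
  \<open>y\<close> crosses it; for \<open>x = y\<close> the latter is impossible.\<close>

lemma conn_union:
  assumes "symp E" "conn E X" "conn E Y" "x \<in> X" "y \<in> Y" "x = y \<or> E x y"
  shows "conn E (X \<union> Y)"
  unfolding conn_def
proof (intro conjI allI impI)
  show "X \<union> Y \<noteq> {}" using assms by auto
  fix Q assume Q: "Q \<subseteq> X \<union> Y" "Q \<noteq> {} \<and> Q \<noteq> X \<union> Y"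
  show "\<exists>q\<in>Q. \<exists>r\<in>X \<union> Y - Q. E q r"
  proof (cases "(Q \<inter> X = {} \<or> Q \<inter> X = X) \<and> (Q \<inter> Y = {} \<or> Q \<inter> Y = Y)")
    case True
    then have "(x \<in> Q \<and> y \<notin> Q) \<or> (y \<in> Q \<and> x \<notin> Q)"
      using Q assms(4,5) by blast
    then show ?thesis using assms(1,4,5,6) by (auto dest: sympD)
  next
    case False
    then consider "Q \<inter> X \<noteq> {}" "Q \<inter> X \<noteq> X" | "Q \<inter> Y \<noteq> {}" "Q \<inter> Y \<noteq> Y" by blast
    then show ?thesis
    proof cases
      case 1
      obtain q r where "q \<in> Q \<inter> X" "r \<in> X - Q \<inter> X" "E q r"
        by (rule connE[OF assms(2), of "Q \<inter> X"]) (use 1 in auto)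
      then show ?thesis by blast
    next
      case 2
      obtain q r where "q \<in> Q \<inter> Y" "r \<in> Y - Q \<inter> Y" "E q r"
        by (rule connE[OF assms(3), of "Q \<inter> Y"]) (use 2 in auto)
      then show ?thesis by blast
    qed
  qed
qed

lemma conn_insert:
  assumes "symp E" "conn E X" "x \<in> X" "E x v"
  shows "conn E (insert v X)"
  using conn_union[OF assms(1,2) conn_singleton assms(3), of v v] assms(4) by simp

lemma deg_sum: "finite T \<Longrightarrow> deg E v T = (\<Sum>u\<in>T. of_bool (E v u))"
  unfolding deg_def by (simp add: of_bool_def sum.If_cases Int_def)

lemma deg_Un_disjoint:
  assumes "finite A" "finite B" "A \<inter> B = {}"
  shows "deg E v (A \<union> B) = deg E v A + deg E v B"
  using assms by (simp add: deg_sum sum.union_disjoint del: sum_of_bool_eq)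

lemma deg_Union_disjoint:
  assumes "finite \<K>" "\<And>K. K \<in> \<K> \<Longrightarrow> finite K" "disjoint \<K>"
  shows "deg E v (\<Union>\<K>) = (\<Sum>K\<in>\<K>. deg E v K)"
proof -
  have "deg E v (\<Union>\<K>) = (\<Sum>u\<in>\<Union>\<K>. of_bool (E v u))"
    using assms by (subst deg_sum) auto
  also have "\<dots> = (\<Sum>K\<in>\<K>. \<Sum>u\<in>K. of_bool (E v u))"
    using assms by (subst sum.Union_disjoint) (auto simp: disjoint_def)
  also have "\<dots> = (\<Sum>K\<in>\<K>. deg E v K)"
    using assms by (intro sum.cong) (auto simp: deg_sum)
  finally show ?thesis .
qed

lemma deg_le_card: "finite T \<Longrightarrow> deg E v T \<le> card T"
  unfolding deg_def by (rule card_mono) auto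

lemma deg_le_card_minus:
  assumes "finite T" "v \<in> T" "\<not> E v v"
  shows "deg E v T \<le> card T - 1"
proof -
  have "{u \<in> T. E v u} \<subseteq> T - {v}" using assms by auto
  then have "deg E v T \<le> card (T - {v})" unfolding deg_def using assms by (intro card_mono) auto
  then show ?thesis using assms by simp
qed

lemma deg_eq_0: "(\<And>u. u \<in> T \<Longrightarrow> \<not> E v u) \<Longrightarrow> deg E v T = 0"
  unfolding deg_def by (auto simp: card_eq_0_iff)

text \<open>Each obstructed \<open>w\<close> leaves a piece of \<open>K - {w}\<close> that \<open>d\<close> does not reach. These pieces are
  pairwise disjoint, because a common part could only be left through two different vertices, and
  by minimality each contains a vertex of \<open>S\<close>.\<close>

lemma card_obstructed_le_missed:
  assumes sym: "symp E" and K: "conn E K" "finite K" and d: "d \<notin> K"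
    and prune: "\<And>Q. Q \<subseteq> K \<Longrightarrow> Q \<noteq> {} \<Longrightarrow> Q \<inter> S = {} \<Longrightarrow> \<not> conn E (K - Q)"
  shows "card {w \<in> K - S. E d w \<and> \<not> conn E (insert d (K - {w}))} \<le> card {r \<in> K \<inter> S. \<not> E d r}"
proof -
  define B where "B = {w \<in> K - S. E d w \<and> \<not> conn E (insert d (K - {w}))}"
  \<comment> \<open>A piece that \<open>d\<close> does not reach once \<open>w\<close> is gone: no
    edge leaves \<open>Q\<close> within \<open>insert d (K - {w})\<close>, and \<open>d\<close> lies
    outside \<open>Q\<close>.\<close>
  define cl where "cl w Q \<longleftrightarrow> Q \<noteq> {} \<and> Q \<subseteq> K - {w} \<and>
    (\<forall>q\<in>Q. \<forall>r\<in>insert d (K - {w}) - Q. \<not> E q r)" for w Q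
  have symD: "E u v \<Longrightarrow> E v u" for u v using sym by (auto dest: sympD)
  have ex: "\<exists>Q. cl w Q" if "w \<in> B" for w
  proof -
    have "\<not> conn E (insert d (K - {w}))" using that B_def by auto
    then obtain Q where Q: "Q \<subseteq> insert d (K - {w})" "Q \<noteq> {}" "Q \<noteq> insert d (K - {w})"
      "\<And>q r. q \<in> Q \<Longrightarrow> r \<in> insert d (K - {w}) - Q \<Longrightarrow> \<not> E q r"
      unfolding conn_def by blast
    show ?thesis
    proof (cases "d \<in> Q")
      case True
      \<comment> \<open>By symmetry the complement of a set without outgoing edges has none either,
        so the side avoiding \<open>d\<close> can be taken.\<close>
      have "cl w (insert d (K - {w}) - Q)" unfolding cl_def using Q True symD by blast
      then show ?thesis ..
    next
      case False
      then have "cl w Q" unfolding cl_def using Q by blast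
      then show ?thesis ..
    qed
  qed
  define Q where "Q w = (SOME Q. cl w Q)" for w
  have Q: "cl w (Q w)" if "w \<in> B" for w using ex[OF that] unfolding Q_def by (rule someI_ex)
  \<comment> \<open>Inside \<open>K\<close>, an edge leaving \<open>Q w\<close> can only end in
    \<open>w\<close>. Removing \<open>Q w\<close> therefore keeps \<open>K\<close> connected, which
    \<open>prune\<close> forbids if \<open>Q w\<close> avoids \<open>S\<close>.\<close>
  have meets: "Q w \<inter> S \<noteq> {}" if w: "w \<in> B" for w
  proof
    assume "Q w \<inter> S = {}"
    then have nc: "\<not> conn E (K - Q w)" using prune[of "Q w"] Q[OF w] by (auto simp: cl_def)
    have wK: "w \<in> K" "w \<notin> Q w" using w Q[OF w] by (auto simp: B_def cl_def)
    have out: "\<exists>p\<in>P. \<exists>r\<in>K - Q w - P. E p r" if P: "P \<subseteq> K - Q w" "P \<noteq> {}" "w \<notin> P" for P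
    proof -
      obtain p r where pr: "p \<in> P" "r \<in> K - P" "E p r"
        by (rule connE[OF K(1), of P]) (use P wK in auto)
      have "r \<notin> Q w"
      proof
        assume "r \<in> Q w"
        moreover have "p \<in> insert d (K - {w}) - Q w" using pr P by auto
        ultimately show False using Q[OF w] symD[OF pr(3)] unfolding cl_def by blast
      qed
      then show ?thesis using pr by blast
    qed
    have "conn E (K - Q w)" unfolding conn_def
    proof (intro conjI allI impI)
      show "K - Q w \<noteq> {}" using wK by auto
      fix P assume P: "P \<subseteq> K - Q w" "P \<noteq> {} \<and> P \<noteq> K - Q w"
      show "\<exists>q\<in>P. \<exists>r\<in>K - Q w - P. E q r"
      proof (cases "w \<in> P")
        \<comment> \<open>\<open>out\<close> only treats sets avoiding \<open>w\<close>; a set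
          containing \<open>w\<close> is handled through its complement.\<close>
        case True
        have "\<exists>p\<in>K - Q w - P. \<exists>r\<in>K - Q w - (K - Q w - P). E p r"
          by (rule out) (use P True in auto)
        then show ?thesis using symD by blast
      next
        case False
        then show ?thesis using out P by blast
      qed
    qed
    then show False using nc by simp
  qed
  define \<rho> where "\<rho> w = (SOME r. r \<in> Q w \<inter> S)" for w
  have \<rho>: "\<rho> w \<in> Q w \<inter> S" if "w \<in> B" for w
    using meets[OF that] unfolding \<rho>_def by (meson ex_in_conv someI_ex)
  have "inj_on \<rho> B"
  proof (rule inj_onI, rule ccontr)
    fix w w' assume a: "w \<in> B" "w' \<in> B" "\<rho> w = \<rho> w'" "w \<noteq> w'"
    have ne: "Q w \<inter> Q w' \<noteq> {}" using \<rho>[OF a(1)] \<rho>[OF a(2)] a(3) by auto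
    have w: "w \<in> K" "E d w" "w' \<in> K" "E d w'" using a by (auto simp: B_def)
    note c = Q[OF a(1), unfolded cl_def] Q[OF a(2), unfolded cl_def]
    have d': "d \<notin> Q w" "d \<notin> Q w'" using c d by auto
    \<comment> \<open>Both \<open>w\<close> and \<open>w'\<close> are neighbours of
      \<open>d\<close>, so neither lies in a piece without an edge to \<open>d\<close>. An edge
      leaving the intersection of the pieces would then have to end in \<open>w\<close> and in
      \<open>w'\<close> at once.\<close>
    have nw: "w \<notin> Q w'" "w' \<notin> Q w" using c w d' symD by blast+
    obtain q r where qr: "q \<in> Q w \<inter> Q w'" "r \<in> K - Q w \<inter> Q w'" "E q r"
      by (rule connE[OF K(1), of "Q w \<inter> Q w'"]) (use c ne w in auto)
    have "r \<in> Q w \<or> r = w" "r \<in> Q w' \<or> r = w'" using c qr by blast+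
    then show False using qr nw a(4) by blast
  qed
  moreover have "\<rho> ` B \<subseteq> {r \<in> K \<inter> S. \<not> E d r}"
  proof
    fix r assume "r \<in> \<rho> ` B"
    then obtain w where w: "w \<in> B" "r = \<rho> w" by auto
    note c = Q[OF w(1), unfolded cl_def] and r = \<rho>[OF w(1)]
    have "\<not> E r d" using c r w(2) d by blast
    then show "r \<in> {r \<in> K \<inter> S. \<not> E d r}" using c r w(2) symD by blast
  qed
  ultimately have "card B \<le> card {r \<in> K \<inter> S. \<not> E d r}"
    using K(2) by (intro card_inj_on_le[of \<rho>]) auto
  then show ?thesis unfolding B_def .
qed

section \<open>Degree sums inside a single block\<close>

lemma card_filter_sum: "finite A \<Longrightarrow> card {x \<in> A. Q x} = (\<Sum>x\<in>A. of_bool (Q x))"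
  by (simp add: of_bool_def sum.If_cases Int_def)

lemma sum_obstructed_le_missed:
  assumes "symp E" "conn E K" "finite K" "d \<notin> K"
    and "\<And>Q. Q \<subseteq> K \<Longrightarrow> Q \<noteq> {} \<Longrightarrow> Q \<inter> S = {} \<Longrightarrow> \<not> conn E (K - Q)"
  shows "(\<Sum>w\<in>K - S. of_bool (E d w \<and> \<not> conn E (insert d (K - {w}))))
    \<le> (\<Sum>r\<in>K \<inter> S. of_bool (\<not> E d r) :: nat)"
proof -
  have "card {w \<in> K - S. E d w \<and> \<not> conn E (insert d (K - {w}))} \<le> card {r \<in> K \<inter> S. \<not> E d r}"
    by (rule card_obstructed_le_missed[OF assms(1-4)]) (fact assms(5))
  then show ?thesis
    unfolding card_filter_sum[OF finite_Diff[OF assms(3)]] card_filter_sum[OF finite_Int[OF disjI1[OF assms(3)]]] .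
qed

lemma deg_split_S:
  assumes "finite K"
  shows "deg E v K = (\<Sum>u\<in>K \<inter> S. of_bool (E v u)) + (\<Sum>u\<in>K - S. of_bool (E v u))"
proof -
  have "K = (K \<inter> S) \<union> (K - S)" by auto
  then show ?thesis
    using deg_Un_disjoint[of "K \<inter> S" "K - S" E v] assms by (simp add: deg_sum Int_Diff_disjoint)
qed

lemma card_split_S: "finite K \<Longrightarrow> card K = card (K \<inter> S) + card (K - S)"
  by (metis card_Diff_subset_Int card_mono finite_Int inf_le1 le_add_diff_inverse)

text \<open>A vertex outside \<open>S\<close> adjacent to both \<open>x\<close> and \<open>d\<close>
  is obstructed for \<open>d\<close>, and the obstructed vertices are paid for by those of
  \<open>K \<inter> S\<close> that \<open>d\<close> misses. So vertices outside \<open>S\<close>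
  count once and those of \<open>S\<close> twice.\<close>

lemma deg_pair_le:
  assumes "symp E" "conn E K" "finite K" "d \<notin> K"
    and "\<And>Q. Q \<subseteq> K \<Longrightarrow> Q \<noteq> {} \<Longrightarrow> Q \<inter> S = {} \<Longrightarrow> \<not> conn E (K - Q)"
    and no: "\<And>w. w \<in> K - S \<Longrightarrow> E x w \<Longrightarrow> \<not> conn E (insert d (K - {w}))"
  shows "deg E x K + deg E d K \<le> card K + card (K \<inter> S)"
proof -
  let ?b = "\<lambda>w. E d w \<and> \<not> conn E (insert d (K - {w}))"
  have arith: "x1 + x2 + (d1 + d2) \<le> s + v + s"
    if "b \<le> m" "x2 + d2 \<le> v + b" "x1 + d1 + m \<le> s * 2" for x1 x2 d1 d2 s v b m :: nat
    using that by linarith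
  have "(\<Sum>w\<in>K - S. of_bool (?b w)) \<le> (\<Sum>r\<in>K \<inter> S. of_bool (\<not> E d r) :: nat)"
    by (rule sum_obstructed_le_missed[OF assms(1-4)]) (fact assms(5))
  moreover have "(\<Sum>u\<in>K - S. of_bool (E x u) + of_bool (E d u)) \<le> (\<Sum>u\<in>K - S. 1 + of_bool (?b u) :: nat)"
    by (intro sum_mono) (use no in auto)
  moreover have "(\<Sum>u\<in>K \<inter> S. of_bool (E x u) + of_bool (E d u) + of_bool (\<not> E d u)) \<le> (\<Sum>u\<in>K \<inter> S. 2 :: nat)"
    by (intro sum_mono) auto
  ultimately show ?thesis
    unfolding deg_split_S[OF assms(3), of _ _ S] card_split_S[OF assms(3), of S]
      sum.distrib sum_constant of_nat_id mult_1_right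
    by (rule arith)
qed

text \<open>The same charging for two free vertices: a vertex outside \<open>S\<close> adjacent to
  three of \<open>x\<close>, \<open>y\<close>, \<open>a\<close>, \<open>b\<close> is obstructed for
  \<open>a\<close> or for \<open>b\<close>, and for both if adjacent to all four.\<close>

lemma deg_quad_le:
  assumes "symp E" "conn E K" "finite K" "a \<notin> K" "b \<notin> K"
    and prune: "\<And>Q. Q \<subseteq> K \<Longrightarrow> Q \<noteq> {} \<Longrightarrow> Q \<inter> S = {} \<Longrightarrow> \<not> conn E (K - Q)"
    and noa: "\<And>w. w \<in> K - S \<Longrightarrow> conn E (insert a (K - {w})) \<Longrightarrow> E x w \<Longrightarrow> \<not> E y w \<and> \<not> E b w"
    and nob: "\<And>w. w \<in> K - S \<Longrightarrow> conn E (insert b (K - {w})) \<Longrightarrow> E y w \<Longrightarrow> \<not> E x w \<and> \<not> E a w"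
  shows "deg E x K + deg E y K + deg E a K + deg E b K \<le> 2 * card K + 2 * card (K \<inter> S)"
proof -
  let ?b = "\<lambda>d w. E d w \<and> \<not> conn E (insert d (K - {w}))"
  have arith: "x1 + x2 + (y1 + y2) + (a1 + a2) + (b1 + b2) \<le> 2 * (s + v) + 2 * s"
    if "p \<le> m" "q \<le> n" "x2 + y2 + a2 + b2 \<le> v * 2 + p + q" "x1 + y1 + a1 + b1 + m + n \<le> s * 4"
    for x1 x2 y1 y2 a1 a2 b1 b2 s v p q m n :: nat
    using add_mono[OF add_mono[OF that(3,4)] add_mono[OF that(1,2)]] by simp
  have le: "(\<Sum>w\<in>K - S. of_bool (?b d w)) \<le> (\<Sum>r\<in>K \<inter> S. of_bool (\<not> E d r) :: nat)" if "d \<notin> K" for d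
    by (rule sum_obstructed_le_missed[OF assms(1-3) that]) (fact prune)
  note le[OF assms(4)] le[OF assms(5)]
  moreover have "(\<Sum>u\<in>K - S. of_bool (E x u) + of_bool (E y u) + of_bool (E a u) + of_bool (E b u))
      \<le> (\<Sum>u\<in>K - S. 2 + of_bool (?b a u) + of_bool (?b b u) :: nat)"
  proof (intro sum_mono)
    fix u assume "u \<in> K - S"
    then show "of_bool (E x u) + of_bool (E y u) + of_bool (E a u) + of_bool (E b u)
      \<le> (2 + of_bool (?b a u) + of_bool (?b b u) :: nat)"
      using noa[of u] nob[of u] by (auto simp: of_bool_def)
  qed
  moreover have "(\<Sum>u\<in>K \<inter> S. of_bool (E x u) + of_bool (E y u) + of_bool (E a u) + of_bool (E b u)
      + of_bool (\<not> E a u) + of_bool (\<not> E b u)) \<le> (\<Sum>u\<in>K \<inter> S. 4 :: nat)"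
    by (intro sum_mono) (simp add: of_bool_def)
  ultimately show ?thesis
    unfolding deg_split_S[OF assms(3), of _ _ S] card_split_S[OF assms(3), of S]
      sum.distrib sum_constant of_nat_id mult_1_right
    by (rule arith)
qed

section \<open>Optimal systems of blocks\<close>

text \<open>\<open>deg_ge\<close> is the minimum degree bound multiplied by two, with the
  subtraction moved across so that it can be stated in \<open>nat\<close>.\<close>

locale partitioned_graph =
  fixes V :: "'a set" and E :: "'a \<Rightarrow> 'a \<Rightarrow> bool" and S :: "'a set"
    and I :: "'i set" and P :: "'i \<Rightarrow> 'a set"
  assumes fin_V: "finite V" and fin_I: "finite I"
    and sym_E: "symp E" and irrefl_E: "\<not> E v v"
    and S_sub: "S \<subseteq> V" and S_eq: "S = \<Union>(P ` I)"
    and disj_P: "disjoint_family_on P I" and P_ne: "i \<in> I \<Longrightarrow> P i \<noteq> {}"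
    and deg_ge: "v \<in> V \<Longrightarrow> card V + card S \<le> 2 * deg E v V + 2"
    and size_ge: "2 * card S \<le> card V"
begin

lemma fin_S: "finite S"
  using S_sub fin_V finite_subset by auto

lemma E_sym: "E u v \<Longrightarrow> E v u"
  using sym_E by (auto dest: sympD)

lemma P_index_unique: "i \<in> I \<Longrightarrow> j \<in> I \<Longrightarrow> u \<in> P i \<Longrightarrow> u \<in> P j \<Longrightarrow> i = j"
  using disj_P unfolding disjoint_family_on_def by blast

text \<open>The last clause is a budget that prices a block at two vertices: joining two blocks then
  pays for up to two free vertices needed to connect them.\<close>

definition blocks :: "'a set set \<Rightarrow> bool" where
  "blocks \<K> \<longleftrightarrow> \<K> \<subseteq> Pow V \<and> (\<forall>K\<in>\<K>. conn E K \<and> (\<exists>i\<in>I. K \<inter> S \<noteq> {} \<and> K \<inter> S \<subseteq> P i)) \<and>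
     disjoint \<K> \<and> S \<subseteq> \<Union>\<K> \<and> card (\<Union>\<K> - S) + 2 * card \<K> \<le> card S + 2 * card I"

text \<open>Lexicographic: first the number of blocks, then the number of covered vertices.\<close>

definition weight :: "'a set set \<Rightarrow> nat" where
  "weight \<K> = card \<K> * (card V + 1) + card (\<Union>\<K>)"

definition optimal :: "'a set set \<Rightarrow> bool" where
  "optimal \<K> \<longleftrightarrow> blocks \<K> \<and> (\<forall>\<L>. blocks \<L> \<longrightarrow> weight \<K> \<le> weight \<L>)"

definition same_part :: "'a set \<Rightarrow> 'a set \<Rightarrow> bool" where
  "same_part X Y \<longleftrightarrow> (\<exists>i\<in>I. X \<inter> S \<subseteq> P i \<and> Y \<inter> S \<subseteq> P i)"

section \<open>Replacing, merging, exchanging and pruning blocks\<close>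

lemma blocksD:
  assumes "blocks \<K>"
  shows "finite \<K>" "finite (\<Union>\<K>)" "\<Union>\<K> \<subseteq> V" "disjoint \<K>" "S \<subseteq> \<Union>\<K>"
    "card (\<Union>\<K> - S) + 2 * card \<K> \<le> card S + 2 * card I"
    "K \<in> \<K> \<Longrightarrow> finite K" "K \<in> \<K> \<Longrightarrow> K \<subseteq> V" "K \<in> \<K> \<Longrightarrow> conn E K" "K \<in> \<K> \<Longrightarrow> K \<inter> S \<noteq> {}"
proof -
  have sub: "\<K> \<subseteq> Pow V" using assms by (auto simp: blocks_def)
  then show "finite \<K>" "\<Union>\<K> \<subseteq> V" using fin_V finite_subset by auto
  then show "finite (\<Union>\<K>)" using fin_V finite_subset by auto
  show "disjoint \<K>" "S \<subseteq> \<Union>\<K>" "card (\<Union>\<K> - S) + 2 * card \<K> \<le> card S + 2 * card I"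
    using assms by (auto simp: blocks_def)
  show "K \<in> \<K> \<Longrightarrow> finite K" "K \<in> \<K> \<Longrightarrow> K \<subseteq> V"
    using sub fin_V by (auto dest: finite_subset[of K V])
  show "K \<in> \<K> \<Longrightarrow> conn E K" "K \<in> \<K> \<Longrightarrow> K \<inter> S \<noteq> {}" using assms by (auto simp: blocks_def)
qed

lemma block_part: "blocks \<K> \<Longrightarrow> K \<in> \<K> \<Longrightarrow> \<exists>i\<in>I. K \<inter> S \<subseteq> P i"
  unfolding blocks_def by blast

lemma block_unique: "blocks \<K> \<Longrightarrow> K \<in> \<K> \<Longrightarrow> K' \<in> \<K> \<Longrightarrow> u \<in> K \<Longrightarrow> u \<in> K' \<Longrightarrow> K = K'"
  using blocksD(4) unfolding disjoint_def by blast

text \<open>Merging, exchanging and pruning all replace a subfamily by one block with the same trace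
  on \<open>S\<close>, and the budget need only be compared locally.\<close>

lemma blocks_replace:
  assumes b: "blocks \<K>" and A: "\<A> \<subseteq> \<K>" "\<A> \<noteq> {}"
    and i: "i \<in> I" "\<Union>\<A> \<inter> S \<subseteq> P i"
    and L: "L \<subseteq> V" "conn E L" "L \<inter> S = \<Union>\<A> \<inter> S" "L \<inter> \<Union>(\<K> - \<A>) = {}"
    and budget: "card (L - S) + 2 \<le> card (\<Union>\<A> - S) + 2 * card \<A>"
  shows "blocks (insert L (\<K> - \<A>))" (is ?blocks)
    and "card (insert L (\<K> - \<A>)) = card \<K> - card \<A> + 1" (is ?card)
    and "\<Union>(insert L (\<K> - \<A>)) = (\<Union>\<K> - \<Union>\<A>) \<union> L" (is ?Un)
proof -
  note bD = blocksD[OF b]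
  have finA: "finite \<A>" using A bD(1) finite_subset by auto
  obtain K0 where "K0 \<in> \<A>" using A by auto
  then have meet: "L \<inter> S \<noteq> {}" using L(3) bD(10)[of K0] A by blast
  have dj: "\<Union>(\<K> - \<A>) = \<Union>\<K> - \<Union>\<A>"
    using block_unique[OF b] A by fast
  show un: ?Un using dj by auto
  \<comment> \<open>A set disjoint from the remaining blocks could equal one of them only if empty,
    but \<open>L\<close> meets \<open>S\<close>.\<close>
  have notin: "L \<notin> \<K> - \<A>" using L(4) meet by blast
  show cd: ?card
    using notin bD(1) finA A by (simp add: card_Diff_subset)
  have le: "card \<A> \<le> card \<K>" using bD(1) A card_mono by blast
  have "card (\<Union>\<K> - S) = card ((\<Union>\<K> - \<Union>\<A> - S) \<union> (\<Union>\<A> - S))"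
    using A by (intro arg_cong[where f=card]) auto
  also have "\<dots> = card (\<Union>\<K> - \<Union>\<A> - S) + card (\<Union>\<A> - S)"
    using bD(2) A by (intro card_Un_disjoint) (auto intro: finite_subset[of "\<Union>\<A> - S" "\<Union>\<K>"])
  finally have c1: "card (\<Union>\<K> - S) = card (\<Union>\<K> - \<Union>\<A> - S) + card (\<Union>\<A> - S)" .
  have "card (\<Union>(insert L (\<K> - \<A>)) - S) \<le> card (\<Union>\<K> - \<Union>\<A> - S) + card (L - S)"
    unfolding un Un_Diff by (rule card_Un_le)
  then have bud: "card (\<Union>(insert L (\<K> - \<A>)) - S) + 2 * card (insert L (\<K> - \<A>)) \<le> card S + 2 * card I"
    using cd c1 budget bD(6) le by linarith
  have "disjoint (insert L (\<K> - \<A>))"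
    using bD(4) L(4) unfolding disjoint_def by blast
  moreover have "S \<subseteq> \<Union>(insert L (\<K> - \<A>))" using bD(5) L(3) unfolding un by blast
  moreover have "\<forall>K\<in>insert L (\<K> - \<A>). conn E K \<and> (\<exists>i\<in>I. K \<inter> S \<noteq> {} \<and> K \<inter> S \<subseteq> P i)"
    using b L i meet unfolding blocks_def by auto
  moreover have "insert L (\<K> - \<A>) \<subseteq> Pow V" using L(1) bD(8) by auto
  ultimately show ?blocks unfolding blocks_def using bud by blast
qed

lemma not_optimal_if_fewer:
  assumes "optimal \<K>" "blocks \<L>" "card \<L> < card \<K>"
  shows False
proof -
  have "card (\<Union>\<L>) \<le> card V" using blocksD(3)[OF assms(2)] fin_V card_mono by blast
  then have "weight \<L> < (card \<L> + 1) * (card V + 1)" by (simp add: weight_def)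
  also have "\<dots> \<le> card \<K> * (card V + 1)"
    using assms(3) by (intro mult_right_mono) auto
  also have "\<dots> \<le> weight \<K>" by (simp add: weight_def)
  finally have "weight \<L> < weight \<K>" .
  then show False using assms(1,2) unfolding optimal_def by (meson not_le)
qed

text \<open>The union would save one block, worth two in the budget, and this pays for the vertices
  of \<open>T\<close>.\<close>

lemma optimal_no_merge:
  assumes opt: "optimal \<K>" and XY: "X \<in> \<K>" "Y \<in> \<K>" "X \<noteq> Y" "same_part X Y"
    and T: "T \<subseteq> V - \<Union>\<K>" "card T \<le> 2"
  shows "\<not> conn E (X \<union> Y \<union> T)"
proof
  assume c: "conn E (X \<union> Y \<union> T)"
  have b: "blocks \<K>" using opt by (simp add: optimal_def)
  note bD = blocksD[OF b]
  obtain i where i: "i \<in> I" "X \<inter> S \<subseteq> P i" "Y \<inter> S \<subseteq> P i" using XY by (auto simp: same_part_def)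
  have TS: "T \<inter> S = {}" using T bD(5) by auto
  have TV: "T \<subseteq> V" using T by auto
  have dj: "(X \<union> Y \<union> T) \<inter> \<Union>(\<K> - {X, Y}) = {}"
    using block_unique[OF b] XY T by fast
  have "(X \<union> Y \<union> T) - S = (X \<union> Y - S) \<union> T" using TS by auto
  then have "card ((X \<union> Y \<union> T) - S) \<le> card (X \<union> Y - S) + card T" by (simp add: card_Un_le)
  then have bud: "card ((X \<union> Y \<union> T) - S) + 2 \<le> card (\<Union>{X, Y} - S) + 2 * card {X, Y}"
    using T XY by simp
  have A: "{X, Y} \<subseteq> \<K>" "{X, Y} \<noteq> {}" using XY by auto
  have iS: "\<Union>{X, Y} \<inter> S \<subseteq> P i" using i by auto
  have LS: "(X \<union> Y \<union> T) \<inter> S = \<Union>{X, Y} \<inter> S" using TS by auto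
  have LV: "X \<union> Y \<union> T \<subseteq> V" using bD(8) XY TV by auto
  note r = blocks_replace[OF b A i(1) iS LV c LS dj bud]
  have "card {X, Y} \<le> card \<K>" using A bD(1) card_mono by blast
  then have "card (insert (X \<union> Y \<union> T) (\<K> - {X, Y})) < card \<K>" using r(2) XY by simp
  then show False using not_optimal_if_fewer[OF opt r(1)] by blast
qed

text \<open>The exchange preserves both components of the weight, so optimality survives while
  \<open>w\<close> becomes free.\<close>

lemma optimal_swap:
  assumes opt: "optimal \<K>" and K: "K \<in> \<K>" "w \<in> K - S" "d \<in> V - \<Union>\<K>"
    and c: "conn E (insert d (K - {w}))"
  defines "\<L> \<equiv> insert (insert d (K - {w})) (\<K> - {K})"
  shows "optimal \<L>" "\<Union>\<L> = insert d (\<Union>\<K> - {w})"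
    "card (\<Union>\<L>) = card (\<Union>\<K>)"
proof -
  let ?L = "insert d (K - {w})"
  have b: "blocks \<K>" using opt by (simp add: optimal_def)
  note bD = blocksD[OF b]
  obtain i where i: "i \<in> I" "K \<inter> S \<subseteq> P i" using block_part[OF b K(1)] by blast
  have dS: "d \<notin> S" "d \<notin> K" "w \<noteq> d" using K bD(5) by auto
  have A: "{K} \<subseteq> \<K>" "{K} \<noteq> {}" using K by auto
  have iS: "\<Union>{K} \<inter> S \<subseteq> P i" using i by auto
  have LS: "?L \<inter> S = \<Union>{K} \<inter> S" using dS K by auto
  have LV: "?L \<subseteq> V" using bD(8)[OF K(1)] K by auto
  have dj: "?L \<inter> \<Union>(\<K> - {K}) = {}"
    using block_unique[OF b] K by fast
  have fK: "finite K" using bD(7) K by auto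
  have cpos: "card (K - S) > 0" using fK K by (auto simp: card_gt_0_iff)
  have "?L - S = insert d ((K - S) - {w})" using dS by auto
  then have "card (?L - S) = card (K - S)" using fK dS K cpos by simp
  then have bud: "card (?L - S) + 2 \<le> card (\<Union>{K} - S) + 2 * card {K}" by simp
  note r = blocks_replace[OF b A i(1) iS LV c LS dj bud, folded \<L>_def]
  have K_pos: "card \<K> > 0" using bD(1) K by (auto simp: card_gt_0_iff)
  show un: "\<Union>\<L> = insert d (\<Union>\<K> - {w})" unfolding r(3) using K(1,2) by blast
  have "w \<in> \<Union>\<K>" "d \<notin> \<Union>\<K> - {w}" using K by auto
  then show cU: "card (\<Union>\<L>) = card (\<Union>\<K>)"
    unfolding un by (metis bD(2) card_Suc_Diff1 card_insert_disjoint finite_Diff)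
  have "card \<L> = card \<K>" using r(2) K_pos by simp
  then have "weight \<L> = weight \<K>" using cU by (simp add: weight_def)
  then show "optimal \<L>" using r(1) opt by (auto simp: optimal_def)
qed

text \<open>Pruning keeps the number of blocks and covers fewer vertices, against the second
  component of \<open>weight\<close>.\<close>

lemma optimal_no_prune:
  assumes opt: "optimal \<K>" and K: "K \<in> \<K>" "Q \<subseteq> K" "Q \<noteq> {}" "Q \<inter> S = {}"
  shows "\<not> conn E (K - Q)"
proof
  assume c: "conn E (K - Q)"
  have b: "blocks \<K>" using opt by (simp add: optimal_def)
  note bD = blocksD[OF b]
  obtain i where i: "i \<in> I" "K \<inter> S \<subseteq> P i" using block_part[OF b K(1)] by blast
  have A: "{K} \<subseteq> \<K>" "{K} \<noteq> {}" using K by auto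
  have iS: "\<Union>{K} \<inter> S \<subseteq> P i" using i by auto
  have LS: "(K - Q) \<inter> S = \<Union>{K} \<inter> S" using K(4) by blast
  have LV: "K - Q \<subseteq> V" using bD(8)[OF K(1)] by auto
  have dj: "(K - Q) \<inter> \<Union>(\<K> - {K}) = {}"
    using block_unique[OF b K(1)] by blast
  have fK: "finite K" using bD(7) K by auto
  have "card (K - Q - S) \<le> card (K - S)" using fK by (intro card_mono) auto
  then have bud: "card (K - Q - S) + 2 \<le> card (\<Union>{K} - S) + 2 * card {K}" by simp
  note r = blocks_replace[OF b A i(1) iS LV c LS dj bud]
  have K_pos: "card \<K> > 0" using bD(1) K by (auto simp: card_gt_0_iff)
  obtain q where "q \<in> Q" using K by auto
  then have "q \<in> \<Union>\<K>" "q \<notin> \<Union>(insert (K - Q) (\<K> - {K}))" unfolding r(3) using K(1,2) by blast+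
  moreover have "\<Union>(insert (K - Q) (\<K> - {K})) \<subseteq> \<Union>\<K>" unfolding r(3) using K(1) by blast
  ultimately have "\<Union>(insert (K - Q) (\<K> - {K})) \<subset> \<Union>\<K>" by blast
  then have "card (\<Union>(insert (K - Q) (\<K> - {K}))) < card (\<Union>\<K>)" by (rule psubset_card_mono[OF bD(2)])
  then have "weight (insert (K - Q) (\<K> - {K})) < weight \<K>"
    unfolding weight_def using r(2) K_pos by simp
  then show False using opt r(1) unfolding optimal_def by (meson not_le)
qed

section \<open>Degree counts for two blocks of one part\<close>

lemma card_V_split:
  assumes "blocks \<K>"
  shows "card V = card (V - \<Union>\<K>) + (\<Sum>K\<in>\<K>. card K)" "card S = (\<Sum>K\<in>\<K>. card (K \<inter> S))"
    "deg E v V = deg E v (V - \<Union>\<K>) + (\<Sum>K\<in>\<K>. deg E v K)"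
proof -
  note bD = blocksD[OF assms]
  have "card (\<Union>\<K>) = (\<Sum>K\<in>\<K>. card K)"
    using bD(1,4,7) by (intro card_Union_disjoint) (auto simp: disjoint_def pairwise_def disjnt_def)
  moreover have "card V = card (V - \<Union>\<K>) + card (\<Union>\<K>)"
    using fin_V bD(2,3) by (simp add: card_Diff_subset card_mono)
  ultimately show "card V = card (V - \<Union>\<K>) + (\<Sum>K\<in>\<K>. card K)" by simp
  have "S = (\<Union>K\<in>\<K>. K \<inter> S)" using bD(5) by auto
  then have "card S = card (\<Union>K\<in>\<K>. K \<inter> S)" by simp
  also have "\<dots> = (\<Sum>K\<in>\<K>. card (K \<inter> S))"
    using bD(1,4,7) by (intro card_UN_disjoint) (auto simp: disjoint_def)
  finally show "card S = (\<Sum>K\<in>\<K>. card (K \<inter> S))" .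
  have "deg E v (\<Union>\<K>) = (\<Sum>K\<in>\<K>. deg E v K)"
    using bD(1,4,7) by (intro deg_Union_disjoint) auto
  moreover have "deg E v ((V - \<Union>\<K>) \<union> \<Union>\<K>) = deg E v (V - \<Union>\<K>) + deg E v (\<Union>\<K>)"
    using fin_V bD(2) by (intro deg_Un_disjoint) auto
  moreover have "(V - \<Union>\<K>) \<union> \<Union>\<K> = V" using bD(3) by auto
  ultimately show "deg E v V = deg E v (V - \<Union>\<K>) + (\<Sum>K\<in>\<K>. deg E v K)" by simp
qed

lemma sum_remove_two:
  fixes f :: "'b \<Rightarrow> nat"
  assumes "finite A" "x \<in> A" "y \<in> A" "x \<noteq> y"
  shows "sum f A = f x + f y + sum f (A - {x, y})"
proof -
  have "sum f A = sum f {x, y} + sum f (A - {x, y})"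
    using assms by (metis add.commute empty_subsetI insert_subset sum.subset_diff)
  then show ?thesis using assms by simp
qed

context
  fixes \<K> X Y
  assumes opt: "optimal \<K>" and X: "X \<in> \<K>" and Y: "Y \<in> \<K>" and neq: "X \<noteq> Y"
    and part: "same_part X Y"
begin

private lemma b: "blocks \<K>" using opt by (simp add: optimal_def)

text \<open>This and the next two facts exclude connections between \<open>X\<close> and
  \<open>Y\<close> with zero, one and two free inner vertices.\<close>

lemma no_edge_between: "x \<in> X \<Longrightarrow> y \<in> Y \<Longrightarrow> \<not> E x y"
  using optimal_no_merge[OF opt X Y neq part, of "{}"]
    conn_union[OF sym_E blocksD(9)[OF b X] blocksD(9)[OF b Y], of x y] by auto

lemma no_common_neighbour:
  assumes "x \<in> X" "y \<in> Y" "E x d" "E y d"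
  shows "d \<in> \<Union>\<K> \<or> d \<notin> V"
proof (rule ccontr)
  assume "\<not> ?thesis"
  then have "{d} \<subseteq> V - \<Union>\<K>" by auto
  then have "\<not> conn E (X \<union> Y \<union> {d})" using optimal_no_merge[OF opt X Y neq part, of "{d}"] by simp
  moreover have "conn E (insert d X \<union> Y)"
    by (rule conn_union[OF sym_E conn_insert[OF sym_E blocksD(9)[OF b X] assms(1,3)] blocksD(9)[OF b Y], of d y])
      (use assms E_sym in auto)
  ultimately show False by (simp add: Un_commute)
qed

lemma no_path_of_two:
  assumes "x \<in> X" "y \<in> Y" "E x a" "E a b" "E y b"
  shows "a \<in> \<Union>\<K> \<or> a \<notin> V \<or> b \<in> \<Union>\<K> \<or> b \<notin> V"
proof (rule ccontr)
  assume "\<not> ?thesis"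
  then have "{a, b} \<subseteq> V - \<Union>\<K>" by auto
  moreover have "card {a, b} \<le> 2" by (simp add: card_insert_if)
  ultimately have "\<not> conn E (X \<union> Y \<union> {a, b})" using optimal_no_merge[OF opt X Y neq part, of "{a, b}"] by simp
  moreover have "conn E (insert b (insert a X) \<union> Y)"
    by (rule conn_union[OF sym_E conn_insert[OF sym_E conn_insert[OF sym_E blocksD(9)[OF b X] assms(1,3)] _ assms(4)]
       blocksD(9)[OF b Y], of b y])
      (use assms E_sym in auto)
  moreover have "insert b (insert a X) \<union> Y = X \<union> Y \<union> {a, b}" by auto
  ultimately show False by simp
qed

text \<open>Every other block contributes at most its size plus its share of \<open>S\<close>. The
  loss of four arises because neither \<open>x\<close> nor \<open>d\<close> is its own neighbour and
  because the shares \<open>X \<inter> S\<close> and \<open>Y \<inter> S\<close> are not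
  claimed.\<close>

lemma deg_sum_le_without_neighbour:
  assumes d: "d \<in> V - \<Union>\<K>" and x: "x \<in> X"
    and no_nbr: "\<And>u v. u \<in> X \<Longrightarrow> v \<in> V - \<Union>\<K> \<Longrightarrow> \<not> E u v"
    and no_swap: "\<And>K w. K \<in> \<K> - {X, Y} \<Longrightarrow> w \<in> K - S \<Longrightarrow> E x w \<Longrightarrow> \<not> conn E (insert d (K - {w}))"
  shows "deg E x V + deg E d V + 4 \<le> card V + card S"
proof -
  note bD = blocksD[OF b]
  have "deg E x K + deg E d K \<le> card K + card (K \<inter> S)" if K: "K \<in> \<K> - {X, Y}" for K
  proof (rule deg_pair_le[OF sym_E])
    show "conn E K" "finite K" using bD K by auto
    show "d \<notin> K" using d K by auto
    show "\<And>Q. Q \<subseteq> K \<Longrightarrow> Q \<noteq> {} \<Longrightarrow> Q \<inter> S = {} \<Longrightarrow> \<not> conn E (K - Q)"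
      using optimal_no_prune[OF opt] K by auto
  qed (use no_swap K in auto)
  then have "(\<Sum>K\<in>\<K> - {X, Y}. deg E x K + deg E d K) \<le> (\<Sum>K\<in>\<K> - {X, Y}. card K + card (K \<inter> S))"
    by (intro sum_mono) auto
  then have s: "(\<Sum>K\<in>\<K> - {X, Y}. deg E x K) + (\<Sum>K\<in>\<K> - {X, Y}. deg E d K)
      \<le> (\<Sum>K\<in>\<K> - {X, Y}. card K) + (\<Sum>K\<in>\<K> - {X, Y}. card (K \<inter> S))" by (simp add: sum.distrib)
  have fX: "finite X" "finite Y" using bD X Y by auto
  have fD: "finite (V - \<Union>\<K>)" using fin_V by auto
  have "deg E x (V - \<Union>\<K>) = 0" using no_nbr x by (intro deg_eq_0) auto
  moreover have "deg E d (V - \<Union>\<K>) \<le> card (V - \<Union>\<K>) - 1" using d irrefl_E fD by (intro deg_le_card_minus) auto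
  moreover have "deg E x X \<le> card X - 1" using x irrefl_E fX by (intro deg_le_card_minus) auto
  moreover have "deg E x Y = 0" using no_edge_between x by (intro deg_eq_0) auto
  moreover have "deg E d X = 0" using no_nbr d E_sym by (intro deg_eq_0) blast
  moreover have "deg E d Y \<le> card Y" by (rule deg_le_card[OF fX(2)])
  moreover have "card (V - \<Union>\<K>) > 0" using fD d by (auto simp: card_gt_0_iff)
  moreover have "card X > 0" using fX x by (auto simp: card_gt_0_iff)
  moreover have "card (X \<inter> S) > 0" "card (Y \<inter> S) > 0" using bD(10) X Y fX by (auto simp: card_gt_0_iff)
  moreover note s
  ultimately show ?thesis
    unfolding card_V_split[OF b] sum_remove_two[OF bD(1) X Y neq] by linarith
qed

end

section \<open>Two blocks of one part contradict optimality\<close>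

lemma same_part_commute: "same_part X Y \<longleftrightarrow> same_part Y X"
  unfolding same_part_def by blast

text \<open>After the exchange \<open>w\<close> is free and adjacent to \<open>x\<close>: an edge to
  \<open>y\<close> would make it a common free neighbour, and an edge to \<open>e\<close> would give
  the free path \<open>x\<close>, \<open>w\<close>, \<open>e\<close>, \<open>y\<close>.\<close>

lemma optimal_swap_no_merge:
  assumes opt: "optimal \<K>" and XY: "X \<in> \<K>" "Y \<in> \<K>" "X \<noteq> Y" "same_part X Y"
    and K: "K \<in> \<K> - {X, Y}" "w \<in> K - S" and d: "d \<in> V - \<Union>\<K>"
    and c: "conn E (insert d (K - {w}))" and x: "x \<in> X" "E x w" and y: "y \<in> Y"
    and e: "e \<in> V - \<Union>\<K>" "e \<noteq> d" "E y e"
  shows "\<not> E y w \<and> \<not> E e w"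
proof -
  define \<L> where "\<L> = insert (insert d (K - {w})) (\<K> - {K})"
  have KK: "K \<in> \<K>" using K by auto
  note sw = optimal_swap[OF opt KK K(2) d c, folded \<L>_def]
  have b: "blocks \<K>" using opt by (simp add: optimal_def)
  have XL: "X \<in> \<L>" "Y \<in> \<L>" using XY K by (auto simp: \<L>_def)
  have wV: "w \<in> V" using blocksD(8)[OF b KK] K by auto
  have wd: "w \<noteq> d" using K d by auto
  have w: "w \<in> V - \<Union>\<L>" unfolding sw(2) using wV wd by auto
  have e': "e \<in> V - \<Union>\<L>" unfolding sw(2) using e by auto
  show ?thesis
    using no_common_neighbour[OF sw(1) XL XY(3,4) x(1) y x(2)]
      no_path_of_two[OF sw(1) XL XY(3,4) x(1) y x(2) _ e(3)] w e' E_sym by blast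
qed

text \<open>The loss of eight: two among the free vertices, two because \<open>x\<close> and
  \<open>y\<close> are not their own neighbours, and four because the doubled shares of
  \<open>S\<close> in \<open>X\<close> and \<open>Y\<close> are not claimed.\<close>

lemma deg_sum_le_with_neighbours:
  assumes opt: "optimal \<K>" and XY: "X \<in> \<K>" "Y \<in> \<K>" "X \<noteq> Y" "same_part X Y"
    and a: "a \<in> V - \<Union>\<K>" "x \<in> X" "E x a" and b: "b \<in> V - \<Union>\<K>" "y \<in> Y" "E y b"
  shows "deg E x V + deg E y V + deg E a V + deg E b V + 8 \<le> 2 * (card V + card S)"
proof -
  have bl: "blocks \<K>" using opt by (simp add: optimal_def)
  note bD = blocksD[OF bl]
  note no_common = no_common_neighbour[OF opt XY] and no_path = no_path_of_two[OF opt XY]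
  have ab: "a \<noteq> b" using no_common[OF a(2) b(2) a(3)] a b by auto
  have YX: "Y \<noteq> X" "same_part Y X" using XY same_part_commute by auto
  have "deg E x K + deg E y K + deg E a K + deg E b K \<le> 2 * card K + 2 * card (K \<inter> S)"
    if K: "K \<in> \<K> - {X, Y}" for K
  proof (rule deg_quad_le[OF sym_E])
    show "conn E K" "finite K" using bD K by auto
    show "a \<notin> K" "b \<notin> K" using a b K by auto
    show "\<And>Q. Q \<subseteq> K \<Longrightarrow> Q \<noteq> {} \<Longrightarrow> Q \<inter> S = {} \<Longrightarrow> \<not> conn E (K - Q)"
      using optimal_no_prune[OF opt] K by auto
    show "\<not> E y w \<and> \<not> E b w" if "w \<in> K - S" "conn E (insert a (K - {w}))" "E x w" for w
      using optimal_swap_no_merge[OF opt XY K that(1) a(1) that(2) a(2) that(3) b(2,1) _ b(3)] ab by auto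
    have K': "K \<in> \<K> - {Y, X}" using K by auto
    show "\<not> E x w \<and> \<not> E a w" if "w \<in> K - S" "conn E (insert b (K - {w}))" "E y w" for w
      using optimal_swap_no_merge[OF opt XY(2,1) YX K' that(1) b(1) that(2) b(2) that(3) a(2,1) _ a(3)] ab by auto
  qed
  then have "(\<Sum>K\<in>\<K> - {X, Y}. deg E x K + deg E y K + deg E a K + deg E b K)
      \<le> (\<Sum>K\<in>\<K> - {X, Y}. 2 * card K + 2 * card (K \<inter> S))"
    by (intro sum_mono) auto
  then have s: "(\<Sum>K\<in>\<K> - {X, Y}. deg E x K) + (\<Sum>K\<in>\<K> - {X, Y}. deg E y K)
      + (\<Sum>K\<in>\<K> - {X, Y}. deg E a K) + (\<Sum>K\<in>\<K> - {X, Y}. deg E b K)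
      \<le> 2 * (\<Sum>K\<in>\<K> - {X, Y}. card K) + 2 * (\<Sum>K\<in>\<K> - {X, Y}. card (K \<inter> S))"
    by (simp add: sum.distrib sum_distrib_left)
  define D where "D = V - \<Union>\<K>"
  have fD: "finite D" using fin_V by (auto simp: D_def)
  define N where "N v = {u \<in> D. E v u}" for v
  have fN: "finite (N v)" for v using fD by (auto simp: N_def)
  have nab: "\<not> E a b" using no_path[OF a(2) b(2) a(3) _ b(3)] a b by auto
  \<comment> \<open>\<open>N x\<close>, \<open>N y\<close> and \<open>N a \<inter> N b\<close> are
    pairwise disjoint, since a common vertex would give a free path with at most two inner vertices,
    such as \<open>x\<close>, \<open>u\<close>, \<open>b\<close>, \<open>y\<close>.\<close>
  have "N x \<inter> N y = {}" using no_common[OF a(2) b(2)] by (auto simp: N_def D_def)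
  moreover have "(N x \<union> N y) \<inter> (N a \<inter> N b) = {}"
  proof (rule ccontr)
    assume "\<not> ?thesis"
    then obtain u where u: "u \<in> V - \<Union>\<K>" "E a u" "E b u" "E x u \<or> E y u" by (auto simp: N_def D_def)
    show False using u(4)
    proof
      assume "E x u"
      then show False using no_path[OF a(2) b(2) _ _ b(3), of u] u E_sym b by auto
    next
      assume "E y u"
      then show False using no_path[OF a(2) b(2) a(3) u(2)] u a by auto
    qed
  qed
  ultimately have "card (N x) + card (N y) + card (N a \<inter> N b) = card (N x \<union> N y \<union> (N a \<inter> N b))"
    using fN by (simp add: card_Un_disjoint)
  also have "\<dots> \<le> card D" using fD by (intro card_mono) (auto simp: N_def)
  finally have c1: "card (N x) + card (N y) + card (N a \<inter> N b) \<le> card D" .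
  have abD: "{a, b} \<subseteq> D" using a b by (auto simp: D_def)
  \<comment> \<open>Neither \<open>a\<close> nor \<open>b\<close> is adjacent to \<open>a\<close> or
    \<open>b\<close>; this is the loss of two.\<close>
  have "N a \<union> N b \<subseteq> D - {a, b}" using nab irrefl_E E_sym by (auto simp: N_def)
  then have "card (N a \<union> N b) \<le> card (D - {a, b})" using fD by (intro card_mono) auto
  also have "\<dots> + 2 = card D"
    using abD ab fD card_mono[OF fD abD] by (simp add: card_Diff_subset)
  finally have c2: "card (N a \<union> N b) + 2 \<le> card D" by simp
  have c3: "card (N a) + card (N b) = card (N a \<union> N b) + card (N a \<inter> N b)"
    using fN by (intro card_Un_Int) auto
  have D_le: "deg E x D + deg E y D + deg E a D + deg E b D + 2 \<le> 2 * card D"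
    using c1 c2 c3 unfolding deg_def N_def by linarith
  have fX: "finite X" "finite Y" using bD XY by auto
  have "deg E x Y = 0" using no_edge_between[OF opt XY] a by (intro deg_eq_0) auto
  then have x_le: "deg E x X + deg E x Y + 1 \<le> card X"
    using deg_le_card_minus[where E = E, OF fX(1) a(2) irrefl_E[of x]] card_gt_0_iff[of X] fX a(2) by auto
  have "deg E y X = 0" using no_edge_between[OF opt XY] b E_sym by (intro deg_eq_0) blast
  then have y_le: "deg E y X + deg E y Y + 1 \<le> card Y"
    using deg_le_card_minus[where E = E, OF fX(2) b(2) irrefl_E[of y]] card_gt_0_iff[of Y] fX b(2) by auto
  have "deg E a Y = 0" using no_common[OF a(2) _ a(3)] a E_sym by (intro deg_eq_0) blast
  then have a_le: "deg E a X + deg E a Y \<le> card X" using deg_le_card[OF fX(1), of E a] by simp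
  have "deg E b X = 0" using no_common[OF _ b(2) _ b(3)] b E_sym by (intro deg_eq_0) blast
  then have b_le: "deg E b X + deg E b Y \<le> card Y" using deg_le_card[OF fX(2), of E b] by simp
  have "card (X \<inter> S) \<ge> 1" "card (Y \<inter> S) \<ge> 1" using bD(10) XY fX by (auto simp: Suc_le_eq card_gt_0_iff)
  then have own: "(deg E x X + deg E x Y) + (deg E y X + deg E y Y) + (deg E a X + deg E a Y)
      + (deg E b X + deg E b Y) + 6 \<le> 2 * (card X + card Y) + 2 * (card (X \<inter> S) + card (Y \<inter> S))"
    using add_mono[OF add_mono[OF x_le y_le] add_mono[OF a_le b_le]] by simp
  show ?thesis
    unfolding card_V_split[OF bl, folded D_def] sum_remove_two[OF bD(1) XY(1-3)]
    using add_mono[OF add_mono[OF own s] D_le] by simp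
qed

text \<open>If \<open>X\<close> has no free neighbour, the degree sum of \<open>x\<close> and
  \<open>d\<close> forces an exchange of \<open>d\<close> for a neighbour \<open>w\<close> of
  \<open>x\<close> in a third block. Only \<open>d\<close> can be used up, so a second application
  can spare a chosen free vertex.\<close>

lemma optimal_obtain_neighbour:
  assumes opt: "optimal \<K>" and XY: "X \<in> \<K>" "Y \<in> \<K>" "X \<noteq> Y" "same_part X Y"
    and d: "d \<in> V - \<Union>\<K>"
  obtains \<L> x v where "optimal \<L>" "X \<in> \<L>" "Y \<in> \<L>" "x \<in> X" "v \<in> V - \<Union>\<L>" "E x v"
    "V - \<Union>\<K> - {d} \<subseteq> V - \<Union>\<L>" "card (\<Union>\<L>) = card (\<Union>\<K>)"
proof (cases "\<exists>u\<in>X. \<exists>v\<in>V - \<Union>\<K>. E u v")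
  case True
  then show ?thesis using that[OF opt XY(1,2)] by blast
next
  case False
  have b: "blocks \<K>" using opt by (simp add: optimal_def)
  obtain x where x: "x \<in> X" using blocksD(10)[OF b XY(1)] by auto
  have "\<exists>K w. K \<in> \<K> - {X, Y} \<and> w \<in> K - S \<and> E x w \<and> conn E (insert d (K - {w}))"
  proof (rule ccontr)
    assume "\<not> ?thesis"
    then have "deg E x V + deg E d V + 4 \<le> card V + card S"
      using deg_sum_le_without_neighbour[OF opt XY d x] False by blast
    moreover have "x \<in> V" using blocksD(8)[OF b XY(1)] x by auto
    ultimately show False using deg_ge[of x] deg_ge[of d] d by auto
  qed
  then obtain K w where K: "K \<in> \<K>" "K \<noteq> X" "K \<noteq> Y" "w \<in> K - S" "E x w" "conn E (insert d (K - {w}))" by auto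
  note sw = optimal_swap[OF opt K(1,4) d K(6)]
  have "w \<in> V" "w \<noteq> d" using blocksD(8)[OF b K(1)] K d by auto
  then have w: "w \<in> V - \<Union>(insert (insert d (K - {w})) (\<K> - {K}))" unfolding sw(2) by auto
  have sub: "V - \<Union>\<K> - {d} \<subseteq> V - \<Union>(insert (insert d (K - {w})) (\<K> - {K}))" unfolding sw(2) by auto
  show ?thesis using XY(1,2) K(2,3)
    by (intro that[OF sw(1) _ _ x w K(5) sub sw(3)]) auto
qed

lemma optimal_not_same_part:
  assumes opt: "optimal \<K>" and XY: "X \<in> \<K>" "Y \<in> \<K>" "X \<noteq> Y"
  shows "\<not> same_part X Y"
proof
  assume part: "same_part X Y"
  have b: "blocks \<K>" using opt by (simp add: optimal_def)
  note bD = blocksD[OF b]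
  \<comment> \<open>Every part is still met when \<open>X\<close> is left out, since
    \<open>Y\<close> stands in for it; so there are more blocks than parts.\<close>
  have meets: "\<exists>K\<in>\<K> - {X}. K \<inter> S \<subseteq> P i" if i: "i \<in> I" for i
  proof -
    obtain p where p: "p \<in> P i" using P_ne i by auto
    then obtain K where K: "K \<in> \<K>" "p \<in> K" using bD(5) S_eq i by blast
    obtain j where j: "j \<in> I" "K \<inter> S \<subseteq> P j" using block_part[OF b K(1)] by auto
    have "j = i" using P_index_unique[OF j(1) i, of p] p j K S_eq i by auto
    then have Ki: "K \<inter> S \<subseteq> P i" using j by simp
    show ?thesis
    proof (cases "K = X")
      case True
      obtain l where l: "l \<in> I" "X \<inter> S \<subseteq> P l" "Y \<inter> S \<subseteq> P l" using part by (auto simp: same_part_def)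
      have "l = i" using P_index_unique[OF l(1) i, of p] p l K S_eq i True by auto
      then show ?thesis using l XY by auto
    qed (use K Ki in auto)
  qed
  then obtain f where f: "\<And>i. i \<in> I \<Longrightarrow> f i \<in> \<K> - {X} \<and> f i \<inter> S \<subseteq> P i" by metis
  have "inj_on f I"
  proof (rule inj_onI)
    fix i j assume ij: "i \<in> I" "j \<in> I" "f i = f j"
    obtain p where "p \<in> f i \<inter> S" using bD(10)[of "f i"] f[OF ij(1)] by auto
    then show "i = j" using f[OF ij(1)] f[OF ij(2)] ij P_index_unique[of i j p] by auto
  qed
  moreover have "f ` I \<subseteq> \<K> - {X}" using f by auto
  ultimately have "card I \<le> card (\<K> - {X})" using bD(1) by (intro card_inj_on_le) auto
  then have "card I + 1 \<le> card \<K>"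
    using bD(1) XY(1) by (metis card_Suc_Diff1 Suc_eq_plus1 add_le_mono1)
  \<comment> \<open>With more than \<open>card I\<close> blocks the budget allows at most
    \<open>card S - 2\<close> used vertices outside \<open>S\<close>, so at least two vertices are
    free.\<close>
  then have "card (\<Union>\<K> - S) + 2 \<le> card S" using bD(6) by linarith
  moreover have "card (\<Union>\<K>) = card (\<Union>\<K> - S) + card S"
    using bD(2,5) fin_S by (simp add: card_Diff_subset card_mono)
  ultimately have le: "card (\<Union>\<K>) + 2 \<le> card V" using size_ge by linarith
  have free: "\<exists>d \<in> V - \<Union>\<L>. d \<noteq> a" if L: "blocks \<L>" "card (\<Union>\<L>) = card (\<Union>\<K>)" for \<L> a
  proof (rule ccontr)
    assume "\<not> ?thesis"
    then have "V \<subseteq> insert a (\<Union>\<L>)" by auto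
    then have "card V \<le> card (insert a (\<Union>\<L>))" using blocksD(2)[OF L(1)] by (intro card_mono) auto
    also have "\<dots> \<le> card (\<Union>\<L>) + 1" by (simp add: card_insert_le_m1 card_insert_if blocksD(2)[OF L(1)])
    finally show False using le L(2) by linarith
  qed
  obtain d where d: "d \<in> V - \<Union>\<K>" using free[OF b refl] by blast
  obtain \<L> x a where L: "optimal \<L>" "X \<in> \<L>" "Y \<in> \<L>" "x \<in> X" "a \<in> V - \<Union>\<L>" "E x a"
    "card (\<Union>\<L>) = card (\<Union>\<K>)"
    by (rule optimal_obtain_neighbour[OF opt XY part d])
  have bL: "blocks \<L>" using L(1) by (simp add: optimal_def)
  \<comment> \<open>Spending \<open>e\<close> instead of \<open>a\<close> keeps \<open>a\<close>
    free while \<open>Y\<close> obtains its neighbour.\<close>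
  obtain e where e: "e \<in> V - \<Union>\<L>" "e \<noteq> a" using free[OF bL L(7)] by blast
  have part': "same_part Y X" using part same_part_commute by simp
  obtain \<M> y c where M: "optimal \<M>" "Y \<in> \<M>" "X \<in> \<M>" "y \<in> Y" "c \<in> V - \<Union>\<M>" "E y c"
    "V - \<Union>\<L> - {e} \<subseteq> V - \<Union>\<M>"
    by (rule optimal_obtain_neighbour[OF L(1,3,2) XY(3)[symmetric] part' e(1)])
  have a: "a \<in> V - \<Union>\<M>" using M(7) L(5) e(2) by auto
  \<comment> \<open>This upper bound is four below the lower bound that \<open>deg_ge\<close> gives
    at these four vertices.\<close>
  have "deg E x V + deg E y V + deg E a V + deg E c V + 8 \<le> 2 * (card V + card S)"
    by (rule deg_sum_le_with_neighbours[OF M(1,3,2) XY(3) part a L(4,6) M(5,4,6)])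
  moreover have "x \<in> V" "y \<in> V" "a \<in> V" "c \<in> V" using bD(8) XY L(4) M(4) a M(5) by auto
  note d = this[THEN deg_ge]
  ultimately show False using add_mono[OF add_mono[OF d(1,2)] add_mono[OF d(3,4)]] by simp
qed

text \<open>In a system of least weight, blocks meeting the same part coincide, so each part lies in
  one block.\<close>

lemma linkage_if_blocks:
  assumes "blocks \<B>"
  shows "\<exists>C. (\<forall>i\<in>I. P i \<subseteq> C i \<and> C i \<subseteq> V \<and> conn E (C i)) \<and> disjoint_family_on C I"
proof -
  obtain \<K> where opt: "optimal \<K>"
    using ex_has_least_nat[of blocks \<B> weight] assms unfolding optimal_def by blast
  then have b: "blocks \<K>" by (simp add: optimal_def)
  note bD = blocksD[OF b]
  have ex: "\<exists>K\<in>\<K>. P i \<subseteq> K \<and> K \<inter> S \<subseteq> P i" if i: "i \<in> I" for i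
  proof -
    have PS: "P i \<subseteq> S" using S_eq i by auto
    have part: "K \<inter> S \<subseteq> P i" if K: "K \<in> \<K>" "p \<in> K" "p \<in> P i" for K p
    proof -
      obtain j where j: "j \<in> I" "K \<inter> S \<subseteq> P j" using block_part[OF b K(1)] by auto
      then show ?thesis using P_index_unique[OF j(1) i, of p] K PS by auto
    qed
    obtain p where p: "p \<in> P i" using P_ne i by auto
    then obtain K where K: "K \<in> \<K>" "p \<in> K" using bD(5) PS by blast
    have "q \<in> K" if q: "q \<in> P i" for q
    proof -
      obtain K' where K': "K' \<in> \<K>" "q \<in> K'" using bD(5) PS q by blast
      have "same_part K K'" unfolding same_part_def using part[OF K p] part[OF K' q] i by blast
      then show ?thesis using optimal_not_same_part[OF opt K(1) K'(1)] K' by auto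
    qed
    then show ?thesis using K part[OF K p] by blast
  qed
  then obtain C where C: "\<And>i. i \<in> I \<Longrightarrow> C i \<in> \<K> \<and> P i \<subseteq> C i \<and> C i \<inter> S \<subseteq> P i" by metis
  have "disjoint_family_on C I" unfolding disjoint_family_on_def
  proof (intro ballI impI)
    fix i j assume ij: "i \<in> I" "j \<in> I" "i \<noteq> j"
    obtain p where p: "p \<in> P i" using P_ne ij by auto
    have pS: "p \<in> S" using p ij S_eq by auto
    have "C i \<noteq> C j" using C[OF ij(1)] C[OF ij(2)] p pS P_index_unique[OF ij(1,2), of p] ij by blast
    then show "C i \<inter> C j = {}"
      using C[OF ij(1)] C[OF ij(2)] bD(4) unfolding disjoint_def by blast
  qed
  moreover have "P i \<subseteq> C i \<and> C i \<subseteq> V \<and> conn E (C i)" if "i \<in> I" for i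
    using C[OF that] bD(8,9)[of "C i"] by blast
  ultimately show ?thesis by blast
qed

end

section \<open>Components with respect to attached vertices\<close>

text \<open>For symmetric \<open>E\<close>, these are the unions of components when vertices of
  \<open>R\<close> are joined by an edge or by a common neighbour in \<open>A\<close>.\<close>

definition closed_in :: "('a \<Rightarrow> 'a \<Rightarrow> bool) \<Rightarrow> 'a set \<Rightarrow> 'a set \<Rightarrow> 'a set \<Rightarrow> bool" where
  "closed_in E R A T \<longleftrightarrow> T \<subseteq> R \<and> (\<forall>u\<in>T. \<forall>v\<in>R. E u v \<longrightarrow> v \<in> T) \<and>
     (\<forall>w\<in>A. \<forall>u\<in>T. \<forall>v\<in>R. E w u \<and> E w v \<longrightarrow> v \<in> T)"

text \<open>The component of \<open>u\<close> if \<open>u\<close> is in \<open>R\<close>; otherwise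
  the intersected family is empty and the value is \<open>UNIV\<close>.\<close>

definition cl :: "('a \<Rightarrow> 'a \<Rightarrow> bool) \<Rightarrow> 'a set \<Rightarrow> 'a set \<Rightarrow> 'a \<Rightarrow> 'a set" where
  "cl E R A u = \<Inter>{T. closed_in E R A T \<and> u \<in> T}"

text \<open>The number of components on \<open>R\<close> when, besides the edges inside \<open>R\<close>, every \<open>w \<in> A\<close> ties all
  its neighbours in \<open>R\<close> together. Edges between vertices of \<open>A\<close> are deliberately ignored: this makes
  the gain of adding a vertex decrease with \<open>A\<close>.\<close>

definition ncl :: "('a \<Rightarrow> 'a \<Rightarrow> bool) \<Rightarrow> 'a set \<Rightarrow> 'a set \<Rightarrow> nat" where
  "ncl E R A = card (cl E R A ` R)"

definition touched :: "('a \<Rightarrow> 'a \<Rightarrow> bool) \<Rightarrow> 'a set \<Rightarrow> 'a set \<Rightarrow> 'a \<Rightarrow> 'a set set" where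
  "touched E R A w = cl E R A ` {r \<in> R. E w r}"

section \<open>Components as closures\<close>

lemma closed_in_self: "closed_in E R A R"
  unfolding closed_in_def by auto

lemma cl_self: "u \<in> cl E R A u"
  unfolding cl_def by auto

lemma cl_subset: "u \<in> R \<Longrightarrow> cl E R A u \<subseteq> R"
  using closed_in_self[of E R A] unfolding cl_def by blast

lemma closed_in_cl:
  assumes "u \<in> R"
  shows "closed_in E R A (cl E R A u)"
proof -
  show ?thesis using cl_subset[OF assms, of E A] unfolding closed_in_def cl_def by blast
qed

lemma cl_least: "closed_in E R A T \<Longrightarrow> u \<in> T \<Longrightarrow> cl E R A u \<subseteq> T"
  unfolding cl_def by blast

lemma closed_in_compl:
  assumes "symp E" "closed_in E R A T"
  shows "closed_in E R A (R - T)"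
  using assms unfolding closed_in_def by (blast dest: sympD)

text \<open>Complements of closed sets are closed, so a closure containing \<open>v\<close> but not
  \<open>u\<close> could be split off from the closure of \<open>u\<close>. Hence the closures
  partition \<open>R\<close>.\<close>

lemma cl_eq:
  assumes "symp E" "u \<in> R" "v \<in> cl E R A u"
  shows "cl E R A v = cl E R A u"
proof (rule equalityI)
  show "cl E R A v \<subseteq> cl E R A u" by (rule cl_least[OF closed_in_cl[OF assms(2)] assms(3)])
  have v: "v \<in> R" using cl_subset[OF assms(2)] assms(3) by blast
  have "u \<in> cl E R A v"
  proof (rule ccontr)
    assume "u \<notin> cl E R A v"
    then have "cl E R A u \<subseteq> R - cl E R A v"
      using cl_least[OF closed_in_compl[OF assms(1) closed_in_cl[OF v]]] assms(2) by blast
    then show False using assms(3) cl_self[of v] by blast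
  qed
  then show "cl E R A u \<subseteq> cl E R A v" by (rule cl_least[OF closed_in_cl[OF v]])
qed

lemma cl_mono:
  assumes "A \<subseteq> B" "u \<in> R"
  shows "cl E R A u \<subseteq> cl E R B u"
proof (rule cl_least)
  show "closed_in E R A (cl E R B u)"
    using closed_in_cl[OF assms(2), of E B] assms(1) unfolding closed_in_def by blast
qed (rule cl_self)

lemma cl_insert_untouched:
  assumes "symp E" "u \<in> R" "cl E R A u \<notin> touched E R A w"
  shows "cl E R (insert w A) u = cl E R A u"
proof (rule equalityI)
  have c: "closed_in E R A (cl E R A u)" by (rule closed_in_cl[OF assms(2)])
  have "\<not> E w r" if "r \<in> cl E R A u" for r
  proof
    assume "E w r"
    moreover have "r \<in> R" using c that by (auto simp: closed_in_def)
    ultimately have "cl E R A r \<in> touched E R A w" by (auto simp: touched_def)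
    then show False using cl_eq[OF assms(1,2) that] assms(3) by simp
  qed
  then have "closed_in E R (insert w A) (cl E R A u)"
    using c unfolding closed_in_def by blast
  then show "cl E R (insert w A) u \<subseteq> cl E R A u" by (rule cl_least[OF _ cl_self])
  show "cl E R A u \<subseteq> cl E R (insert w A) u" by (rule cl_mono) (use assms in auto)
qed

text \<open>The union is closed, as \<open>w\<close> only ties vertices of touched components;
  conversely, one neighbour of \<open>w\<close> in the new closure draws in all the others.\<close>

lemma cl_insert_touched:
  assumes "symp E" "u \<in> R" "cl E R A u \<in> touched E R A w"
  shows "cl E R (insert w A) u = \<Union>(touched E R A w)"
proof (rule equalityI)
  have cR: "closed_in E R A C" "C \<subseteq> R" if C: "C \<in> touched E R A w" for C
  proof -
    obtain r where "r \<in> R" "C = cl E R A r" using C by (auto simp: touched_def)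
    then show "closed_in E R A C" "C \<subseteq> R" using closed_in_cl[of r R E A] cl_subset[of r R E A] by auto
  qed
  have "closed_in E R (insert w A) (\<Union>(touched E R A w))"
    unfolding closed_in_def
  proof (intro conjI ballI impI)
    show "\<Union>(touched E R A w) \<subseteq> R" using cR(2) by blast
    fix x v assume x: "x \<in> \<Union>(touched E R A w)" and v: "v \<in> R"
    then obtain C where C: "C \<in> touched E R A w" "x \<in> C" by blast
    show "v \<in> \<Union>(touched E R A w)" if "E x v"
      using cR(1)[OF C(1)] C v that unfolding closed_in_def by blast
    fix z assume "z \<in> insert w A" "E z x \<and> E z v"
    then consider "E w v" | "z \<in> A" "E z x" "E z v" by blast
    then show "v \<in> \<Union>(touched E R A w)"
    proof cases
      case 1
      then have "cl E R A v \<in> touched E R A w" using v by (auto simp: touched_def)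
      then show ?thesis using cl_self[of v E R A] by blast
    next
      case 2
      then show ?thesis using cR(1)[OF C(1)] C v unfolding closed_in_def by blast
    qed
  qed
  then show "cl E R (insert w A) u \<subseteq> \<Union>(touched E R A w)"
    by (rule cl_least) (use assms(3) cl_self[of u E R A] in auto)
  have cu: "closed_in E R (insert w A) (cl E R (insert w A) u)" by (rule closed_in_cl[OF assms(2)])
  have mono: "cl E R A x \<subseteq> cl E R (insert w A) x" if "x \<in> R" for x by (rule cl_mono) (use that in auto)
  obtain r0 where r0: "r0 \<in> R" "E w r0" "cl E R A u = cl E R A r0" using assms(3) by (auto simp: touched_def)
  have r0u: "r0 \<in> cl E R (insert w A) u" using mono[OF assms(2)] r0(3) cl_self[of r0 E R A] by auto
  show "\<Union>(touched E R A w) \<subseteq> cl E R (insert w A) u"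
  proof
    fix x assume "x \<in> \<Union>(touched E R A w)"
    then obtain r where r: "r \<in> R" "E w r" "x \<in> cl E R A r" by (auto simp: touched_def)
    then have "r \<in> cl E R (insert w A) u" using cu r0u r0(2) unfolding closed_in_def by blast
    then have "cl E R (insert w A) r = cl E R (insert w A) u" by (rule cl_eq[OF assms(1,2)])
    then show "x \<in> cl E R (insert w A) u" using mono[OF r(1)] r(3) by blast
  qed
qed

section \<open>The gain of attaching a vertex\<close>

lemma ncl_insert:
  assumes sym: "symp E" and fin: "finite R"
  shows "int (ncl E R (insert w A)) = int (ncl E R A) - int (card (touched E R A w) - 1)"
proof (cases "touched E R A w = {}")
  \<comment> \<open>With nothing touched, truncated subtraction turns \<open>0 - 1\<close> into the
    correct loss 0.\<close>
  case True
  then have "cl E R (insert w A) ` R = cl E R A ` R"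
    using cl_insert_untouched[OF sym] by (intro image_cong) auto
  then show ?thesis using True by (simp add: ncl_def)
next
  case False
  let ?T = "touched E R A w" and ?c = "cl E R A ` R"
  have sub: "?T \<subseteq> ?c" by (auto simp: touched_def)
  have finT: "finite ?T" using sub fin finite_subset by blast
  have eq: "cl E R (insert w A) ` R = insert (\<Union>?T) (?c - ?T)"
  proof (intro equalityI subsetI)
    fix C assume "C \<in> cl E R (insert w A) ` R"
    then obtain u where u: "u \<in> R" "C = cl E R (insert w A) u" by auto
    show "C \<in> insert (\<Union>?T) (?c - ?T)"
    proof (cases "cl E R A u \<in> ?T")
      case True
      then show ?thesis using cl_insert_touched[OF sym u(1) True] u(2) by simp
    next
      case False
      then show ?thesis using cl_insert_untouched[OF sym u(1) False] u by simp
    qed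
  next
    fix C assume C: "C \<in> insert (\<Union>?T) (?c - ?T)"
    show "C \<in> cl E R (insert w A) ` R"
    proof (cases "C = \<Union>?T")
      case True
      obtain r where r: "r \<in> R" "cl E R A r \<in> ?T" using False by (auto simp: touched_def)
      then show ?thesis using cl_insert_touched[OF sym r] True by auto
    next
      case False
      then obtain u where u: "u \<in> R" "C = cl E R A u" "C \<notin> ?T" using C by auto
      then show ?thesis using cl_insert_untouched[OF sym u(1), of A w] by auto
    qed
  qed
  have "\<Union>?T \<notin> ?c - ?T"
  proof
    assume "\<Union>?T \<in> ?c - ?T"
    then obtain u where u: "u \<in> R" "\<Union>?T = cl E R A u" "cl E R A u \<notin> ?T" by auto
    then obtain r where r: "r \<in> R" "E w r" "u \<in> cl E R A r" using cl_self[of u E R A] by (auto simp: touched_def)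
    have "cl E R A u = cl E R A r" by (rule cl_eq[OF sym r(1,3)])
    then show False using u(3) r by (auto simp: touched_def)
  qed
  then have "card (cl E R (insert w A) ` R) = card (?c - ?T) + 1" unfolding eq using fin by simp
  moreover have "card (?c - ?T) = card ?c - card ?T" using sub finT by (simp add: card_Diff_subset)
  moreover have "card ?T \<le> card ?c" using sub fin by (intro card_mono) auto
  moreover have "card ?T > 0" using False finT by (simp add: card_gt_0_iff)
  ultimately show ?thesis unfolding ncl_def by simp
qed

text \<open>Diminishing gains: components for \<open>B\<close> are unions of components for
  \<open>A\<close>, so neighbours of \<open>w\<close> chosen in distinct touched components for
  \<open>B\<close> lie in distinct touched components for \<open>A\<close>.\<close>

lemma card_touched_antimono:
  assumes sym: "symp E" and fin: "finite R" and AB: "A \<subseteq> B"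
  shows "card (touched E R B w) \<le> card (touched E R A w)"
proof -
  define \<rho> where "\<rho> D = (SOME r. r \<in> {r \<in> R. E w r} \<and> D = cl E R B r)" for D
  have \<rho>: "\<rho> D \<in> {r \<in> R. E w r} \<and> D = cl E R B (\<rho> D)" if "D \<in> touched E R B w" for D
    unfolding \<rho>_def by (rule someI_ex) (use that in \<open>auto simp: touched_def\<close>)
  have "inj_on (\<lambda>D. cl E R A (\<rho> D)) (touched E R B w)"
  proof (rule inj_onI)
    fix D D' assume D: "D \<in> touched E R B w" "D' \<in> touched E R B w" "cl E R A (\<rho> D) = cl E R A (\<rho> D')"
    then have "\<rho> D \<in> cl E R A (\<rho> D')" using cl_self[of "\<rho> D" E R A] by simp
    then have "\<rho> D \<in> cl E R B (\<rho> D')" using cl_mono[OF AB, of "\<rho> D'" R E] \<rho>[OF D(2)] by blast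
    then have "cl E R B (\<rho> D) = cl E R B (\<rho> D')" using cl_eq[OF sym, of "\<rho> D'" R "\<rho> D" B] \<rho>[OF D(2)] by blast
    then show "D = D'" using \<rho>[OF D(1)] \<rho>[OF D(2)] by simp
  qed
  moreover have "(\<lambda>D. cl E R A (\<rho> D)) ` touched E R B w \<subseteq> touched E R A w"
  proof
    fix C assume "C \<in> (\<lambda>D. cl E R A (\<rho> D)) ` touched E R B w"
    then obtain D where "D \<in> touched E R B w" "C = cl E R A (\<rho> D)" by auto
    then show "C \<in> touched E R A w" using \<rho>[of D] unfolding touched_def by blast
  qed
  moreover have "finite (touched E R A w)" using fin by (simp add: touched_def)
  ultimately show ?thesis by (rule card_inj_on_le)
qed

text \<open>Adding the elements of \<open>B\<close> one at a time telescopes to the right-hand side,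
  and each gain is at least the one obtained when that element comes last.\<close>

lemma sum_marginal_le:
  assumes sym: "symp E" and fin: "finite R" and "finite B"
  shows "(\<Sum>w\<in>B. int (ncl E R (A \<union> (B - {w}))) - int (ncl E R (A \<union> B)))
    \<le> int (ncl E R A) - int (ncl E R (A \<union> B))"
  using assms(3)
proof (induction B arbitrary: A rule: finite_induct)
  case (insert b B)
  let ?f = "\<lambda>X. int (ncl E R X)"
  have "(\<Sum>w\<in>B. ?f (A \<union> (insert b B - {w})) - ?f (A \<union> insert b B))
      = (\<Sum>w\<in>B. ?f (insert b A \<union> (B - {w})) - ?f (insert b A \<union> B))"
  proof (intro sum.cong refl)
    fix w assume "w \<in> B"
    then have "A \<union> (insert b B - {w}) = insert b A \<union> (B - {w})" "A \<union> insert b B = insert b A \<union> B"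
      using insert.hyps by auto
    then show "?f (A \<union> (insert b B - {w})) - ?f (A \<union> insert b B)
      = ?f (insert b A \<union> (B - {w})) - ?f (insert b A \<union> B)" by simp
  qed
  also have "\<dots> \<le> ?f (insert b A) - ?f (insert b A \<union> B)" by (rule insert.IH)
  finally have 1: "(\<Sum>w\<in>B. ?f (A \<union> (insert b B - {w})) - ?f (A \<union> insert b B))
    \<le> ?f (insert b A) - ?f (insert b (A \<union> B))" by simp
  have 2: "?f (insert b A) = ?f A - int (card (touched E R A b) - 1)"
    "?f (insert b (A \<union> B)) = ?f (A \<union> B) - int (card (touched E R (A \<union> B) b) - 1)"
    using ncl_insert[OF sym fin] by auto
  have "card (touched E R (A \<union> B) b) \<le> card (touched E R A b)"
    by (rule card_touched_antimono[OF sym fin]) auto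
  then have 3: "?f (A \<union> B) - ?f (insert b (A \<union> B)) \<le> ?f A - ?f (insert b A)" using 2 by linarith
  have "A \<union> (insert b B - {b}) = A \<union> B" "A \<union> insert b B = insert b (A \<union> B)" using insert.hyps by auto
  then show ?case using insert.hyps 1 3 by simp
qed simp

lemma ncl_le_card: "finite R \<Longrightarrow> ncl E R A \<le> card R"
  unfolding ncl_def by (rule card_image_le)

lemma ncl_pos: "finite R \<Longrightarrow> R \<noteq> {} \<Longrightarrow> ncl E R A \<ge> 1"
  unfolding ncl_def by (simp add: Suc_le_eq card_gt_0_iff)

lemma card_touched_le_1:
  assumes sym: "symp E" and "finite R" "w \<in> A"
  shows "card (touched E R A w) \<le> 1"
proof -
  have "C = C'" if C: "C \<in> touched E R A w" "C' \<in> touched E R A w" for C C'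
  proof -
    obtain r where r1: "r \<in> R" "E w r" "C = cl E R A r" using C(1) unfolding touched_def by blast
    obtain r' where "r' \<in> R" "E w r'" "C' = cl E R A r'" using C(2) unfolding touched_def by blast
    note r = r1 this
    have "r' \<in> cl E R A r"
      using closed_in_cl[OF r(1), of E A] cl_self[of r E R A] r assms(3) unfolding closed_in_def by blast
    then show ?thesis using cl_eq[OF sym r(1)] r by blast
  qed
  then show ?thesis using assms(2) by (simp add: card_le_Suc0_iff_eq touched_def)
qed

text \<open>All neighbours of \<open>d\<close> share one component; at worst every other vertex is
  alone.\<close>

lemma ncl_singleton_le:
  assumes "symp E" "finite R"
  shows "ncl E R {d} \<le> 1 + card {r \<in> R. \<not> E d r}"
proof -
  have "cl E R {d} ` R \<subseteq> touched E R {d} d \<union> cl E R {d} ` {r \<in> R. \<not> E d r}" by (auto simp: touched_def)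
  then have "ncl E R {d} \<le> card (touched E R {d} d \<union> cl E R {d} ` {r \<in> R. \<not> E d r})"
    unfolding ncl_def using assms by (intro card_mono) (auto simp: touched_def)
  also have "\<dots> \<le> card (touched E R {d} d) + card (cl E R {d} ` {r \<in> R. \<not> E d r})" by (rule card_Un_le)
  also have "\<dots> \<le> 1 + card {r \<in> R. \<not> E d r}"
    using card_touched_le_1[OF assms, of d "{d}"] assms by (intro add_mono card_image_le) auto
  finally show ?thesis .
qed

section \<open>An economical initial system of blocks\<close>

context partitioned_graph
begin

definition assignment :: "('i \<Rightarrow> 'a set) \<Rightarrow> bool" where
  "assignment U \<longleftrightarrow> (\<forall>i\<in>I. U i \<subseteq> V - S) \<and> disjoint_family_on U I"

text \<open>A component is priced at two vertices, as in the budget of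
  \<open>blocks\<close>.\<close>

definition cost :: "('i \<Rightarrow> 'a set) \<Rightarrow> nat" where
  "cost U = (\<Sum>i\<in>I. card (U i) + 2 * ncl E (P i) (U i))"

lemma assignment_iff:
  "assignment U \<longleftrightarrow> (\<forall>i\<in>I. \<forall>z\<in>U i. z \<in> V - S \<and> (\<forall>j\<in>I. z \<in> U j \<longrightarrow> i = j))"
  unfolding assignment_def disjoint_family_on_def by blast

lemma fin_P: "i \<in> I \<Longrightarrow> finite (P i)"
  using fin_S S_eq finite_subset[of "P i" S] by auto

lemma card_S_sum: "card S = (\<Sum>i\<in>I. card (P i))"
  unfolding S_eq using fin_I fin_P disj_P by (intro card_UN_disjoint) (auto simp: disjoint_family_on_def)

text \<open>At most \<open>card (V - S) - 1\<close> of the neighbours of \<open>d\<close> lie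
  outside \<open>S\<close>; the rest of its degree must lie in \<open>S\<close>.\<close>

lemma card_missed_le:
  assumes "d \<in> V - S"
  shows "2 * card {r \<in> S. \<not> E d r} \<le> card (V - S)"
proof -
  have V: "V = S \<union> (V - S)" using S_sub by auto
  have "deg E d V = deg E d S + deg E d (V - S)"
    by (subst V, rule deg_Un_disjoint) (use fin_S fin_V in auto)
  moreover have "deg E d (V - S) \<le> card (V - S) - 1"
    using assms irrefl_E fin_V by (intro deg_le_card_minus) auto
  moreover have "card (V - S) > 0" using assms fin_V by (auto simp: card_gt_0_iff)
  moreover have "card S = deg E d S + card {r \<in> S. \<not> E d r}"
  proof -
    have "S = {r \<in> S. E d r} \<union> {r \<in> S. \<not> E d r}" by auto
    then have "card S = card ({r \<in> S. E d r} \<union> {r \<in> S. \<not> E d r})" by simp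
    also have "\<dots> = deg E d S + card {r \<in> S. \<not> E d r}"
      unfolding deg_def using fin_S by (intro card_Un_disjoint) auto
    finally show ?thesis .
  qed
  moreover have "card V = card S + card (V - S)" using S_sub fin_S fin_V
    by (simp add: card_Diff_subset card_mono)
  moreover have "card V + card S \<le> 2 * deg E d V + 2" using deg_ge assms by auto
  ultimately show ?thesis by linarith
qed

text \<open>Three non-neighbours in \<open>S\<close> push the degree of \<open>x\<close> out of
  \<open>S\<close>; in the application \<open>x\<close> is one of the three.\<close>

lemma deg_outside_ge:
  assumes x: "x \<in> S" and N: "N \<subseteq> S" "card N = 3" "\<And>v. v \<in> N \<Longrightarrow> \<not> E x v"
  shows "card (V - S) + 4 \<le> 2 * deg E x (V - S)"
proof -
  have V: "V = S \<union> (V - S)" using S_sub by auto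
  have "deg E x V = deg E x S + deg E x (V - S)"
    by (subst V, rule deg_Un_disjoint) (use fin_S fin_V in auto)
  moreover have "{u \<in> S. E x u} \<subseteq> S - N" using N(3) by auto
  then have "deg E x S \<le> card (S - N)" unfolding deg_def using fin_S by (intro card_mono) auto
  moreover have "card (S - N) + 3 = card S"
    using N(1,2) fin_S card_mono[OF fin_S N(1)] by (simp add: card_Diff_subset finite_subset)
  moreover have "card V = card S + card (V - S)" using S_sub fin_S fin_V
    by (simp add: card_Diff_subset card_mono)
  moreover have "card V + card S \<le> 2 * deg E x V + 2" using deg_ge x S_sub by auto
  ultimately show ?thesis by linarith
qed

section \<open>Consequences of minimal cost\<close>

context
  fixes U
  assumes asg: "assignment U" and least: "\<And>U'. assignment U' \<Longrightarrow> cost U \<le> cost U'"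
begin

lemma fin_U: "i \<in> I \<Longrightarrow> finite (U i)"
  using asg fin_V unfolding assignment_def by (meson finite_Diff finite_subset)

lemma cost_update_one:
  assumes "i \<in> I" "assignment (U(i := A))"
  shows "card (U i) + 2 * ncl E (P i) (U i) \<le> card A + 2 * ncl E (P i) A"
proof -
  let ?f = "\<lambda>U j. card (U j) + 2 * ncl E (P j) (U j)"
  have "cost U = ?f U i + (\<Sum>j\<in>I - {i}. ?f U j)"
    unfolding cost_def using fin_I assms(1) by (rule sum.remove)
  moreover have "cost (U(i := A)) = ?f (U(i := A)) i + (\<Sum>j\<in>I - {i}. ?f (U(i := A)) j)"
    unfolding cost_def using fin_I assms(1) by (rule sum.remove)
  moreover have "(\<Sum>j\<in>I - {i}. ?f (U(i := A)) j) = (\<Sum>j\<in>I - {i}. ?f U j)"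
    by (intro sum.cong) auto
  ultimately show ?thesis using least[OF assms(2)] by simp
qed

lemma cost_update_two:
  assumes "i \<in> I" "j \<in> I" "i \<noteq> j" "assignment (U(i := A, j := B))"
  shows "(card (U i) + 2 * ncl E (P i) (U i)) + (card (U j) + 2 * ncl E (P j) (U j))
    \<le> (card A + 2 * ncl E (P i) A) + (card B + 2 * ncl E (P j) B)"
proof -
  let ?f = "\<lambda>U j. card (U j) + 2 * ncl E (P j) (U j)"
  have "cost U = ?f U i + ?f U j + (\<Sum>l\<in>I - {i, j}. ?f U l)"
    unfolding cost_def using fin_I assms(1-3) by (rule sum_remove_two)
  moreover have "cost (U(i := A, j := B)) = ?f (U(i := A, j := B)) i + ?f (U(i := A, j := B)) j
      + (\<Sum>l\<in>I - {i, j}. ?f (U(i := A, j := B)) l)"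
    unfolding cost_def using fin_I assms(1-3) by (rule sum_remove_two)
  moreover have "(\<Sum>l\<in>I - {i, j}. ?f (U(i := A, j := B)) l) = (\<Sum>l\<in>I - {i, j}. ?f U l)"
    by (intro sum.cong) auto
  ultimately show ?thesis using least[OF assms(4)] assms(3) by simp
qed

text \<open>Dropping \<open>w\<close> saves one vertex, so by minimality it must create a
  component.\<close>

lemma marginal_ge_1:
  assumes i: "i \<in> I" and w: "w \<in> U i"
  shows "ncl E (P i) (U i) + 1 \<le> ncl E (P i) (U i - {w})"
proof -
  have "assignment (U(i := U i - {w}))"
    using asg i unfolding assignment_iff by auto
  then have "card (U i) + 2 * ncl E (P i) (U i) \<le> card (U i - {w}) + 2 * ncl E (P i) (U i - {w})"
    by (rule cost_update_one[OF i])
  moreover have "card (U i) = card (U i - {w}) + 1"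
    using fin_U[OF i] w by (metis card_Suc_Diff1 Suc_eq_plus1)
  ultimately show ?thesis by linarith
qed

text \<open>Each \<open>w\<close> accounts for at least one component, and by diminishing gains
  these add up to at most the decrease from \<open>ncl E (P i) {}\<close>, itself at most
  \<open>card (P i)\<close>.\<close>

lemma card_U_le:
  assumes i: "i \<in> I"
  shows "card (U i) + ncl E (P i) (U i) \<le> card (P i)"
proof -
  have "int (card (U i)) = (\<Sum>w\<in>U i. 1)" by simp
  also have "\<dots> \<le> (\<Sum>w\<in>U i. int (ncl E (P i) ({} \<union> (U i - {w}))) - int (ncl E (P i) ({} \<union> U i)))"
    using marginal_ge_1[OF i] by (intro sum_mono) force
  also have "\<dots> \<le> int (ncl E (P i) {}) - int (ncl E (P i) ({} \<union> U i))"
    by (rule sum_marginal_le[OF sym_E fin_P[OF i] fin_U[OF i]])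
  finally show ?thesis using ncl_le_card[OF fin_P[OF i], of E "{}"] by simp
qed

lemma sum_card_U_le: "(\<Sum>i\<in>I. card (U i)) + (\<Sum>i\<in>I. ncl E (P i) (U i)) \<le> card S"
  unfolding card_S_sum sum.distrib[symmetric] using card_U_le by (rule sum_mono)

text \<open>Every part has a component, so fewer than \<open>card S\<close> vertices are assigned,
  while \<open>V - S\<close> has at least \<open>card S\<close>.\<close>

lemma exists_unassigned:
  assumes "I \<noteq> {}"
  shows "\<exists>d \<in> V - S. \<forall>i\<in>I. d \<notin> U i"
proof (rule ccontr)
  assume "\<not> ?thesis"
  then have "V - S \<subseteq> (\<Union>i\<in>I. U i)" by blast
  then have "card (V - S) \<le> card (\<Union>i\<in>I. U i)" using fin_I fin_U by (intro card_mono) auto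
  also have "\<dots> \<le> (\<Sum>i\<in>I. card (U i))" using fin_I by (rule card_UN_le)
  finally have "card V - card S \<le> (\<Sum>i\<in>I. card (U i))" using S_sub fin_S by (simp add: card_Diff_subset)
  moreover have "(\<Sum>i\<in>I. ncl E (P i) (U i)) > 0"
    using assms fin_I ncl_pos[OF fin_P P_ne] by (intro sum_pos) (auto simp: Suc_le_eq)
  ultimately show False using sum_card_U_le size_ge by linarith
qed

text \<open>Charges the mergers that single vertices could still cause in part \<open>i0\<close> to
  vertices of \<open>S\<close> missed by the free vertex \<open>d\<close>. Only vertices assigned to
  other parts can have a gain, and \<open>d\<close> may take their place there.\<close>

lemma sum_gain_le:
  assumes i0: "i0 \<in> I" and d: "d \<in> V - S" "\<forall>i\<in>I. d \<notin> U i"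
  shows "(\<Sum>w\<in>V - S. card (touched E (P i0) (U i0) w) - 1) \<le> card {r \<in> S. \<not> E d r}"
proof -
  define g where "g w = card (touched E (P i0) (U i0) w) - 1" for w
  have ins: "int (ncl E (P i0) (insert w (U i0))) = int (ncl E (P i0) (U i0)) - int (g w)" for w
    unfolding g_def by (rule ncl_insert[OF sym_E fin_P[OF i0]])
  \<comment> \<open>A single merger would save two for the price of one vertex.\<close>
  have free: "g w = 0" if w: "w \<in> V - S" "\<forall>i\<in>I. w \<notin> U i" for w
  proof -
    have "assignment (U(i0 := insert w (U i0)))"
      using asg i0 w unfolding assignment_iff by auto
    then have "card (U i0) + 2 * ncl E (P i0) (U i0)
        \<le> card (insert w (U i0)) + 2 * ncl E (P i0) (insert w (U i0))"
      by (rule cost_update_one[OF i0])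
    moreover have "card (insert w (U i0)) = card (U i0) + 1" using fin_U[OF i0] w i0 by simp
    ultimately show ?thesis using ins[of w] by linarith
  qed
  have own: "g w = 0" if "w \<in> U i0" for w
    using card_touched_le_1[OF sym_E fin_P[OF i0] that] by (simp add: g_def)
  \<comment> \<open>Moving \<open>w\<close> to \<open>i0\<close> and \<open>d\<close> into its place
    adds one vertex. As components count twice, parity removes this one: the mergers gained are at
    most the components lost in part \<open>j\<close>.\<close>
  have other: "int (g w) \<le> int (ncl E (P j) ({d} \<union> (U j - {w}))) - int (ncl E (P j) ({d} \<union> U j))"
    if j: "j \<in> I" "j \<noteq> i0" and w: "w \<in> U j" for j w
  proof -
    have wU: "w \<notin> U i0" using asg j i0 w unfolding assignment_iff by blast
    have "assignment (U(i0 := insert w (U i0), j := insert d (U j - {w})))"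
      using asg i0 j w d wU unfolding assignment_iff by (auto split: if_splits)
    then have "(card (U i0) + 2 * ncl E (P i0) (U i0)) + (card (U j) + 2 * ncl E (P j) (U j))
      \<le> (card (insert w (U i0)) + 2 * ncl E (P i0) (insert w (U i0)))
        + (card (insert d (U j - {w})) + 2 * ncl E (P j) (insert d (U j - {w})))"
      using cost_update_two[OF i0 j(1)] j(2) by blast
    moreover have "card (insert w (U i0)) = card (U i0) + 1" using fin_U[OF i0] wU by simp
    moreover have "card (insert d (U j - {w})) = card (U j)"
      using fin_U[OF j(1)] d j w by (metis card_Suc_Diff1 card_insert_disjoint finite_Diff Diff_iff)
    moreover have "int (ncl E (P j) (insert d (U j))) \<le> int (ncl E (P j) (U j))"
      using ncl_insert[OF sym_E fin_P[OF j(1)], of d "U j"] by linarith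
    ultimately show ?thesis using ins[of w] by simp
  qed
  \<comment> \<open>Diminishing gains bound the sum by the decrease from \<open>{d}\<close> to
    \<open>{d} \<union> U j\<close>, and \<open>d\<close> alone leaves at most one component plus
    one per missed vertex.\<close>
  have part: "(\<Sum>w\<in>U j. g w) \<le> card {r \<in> P j. \<not> E d r}" if j: "j \<in> I" for j
  proof (cases "j = i0")
    case True
    then show ?thesis using own by simp
  next
    case False
    have "int (\<Sum>w\<in>U j. g w) = (\<Sum>w\<in>U j. int (g w))" by simp
    also have "\<dots> \<le> (\<Sum>w\<in>U j. int (ncl E (P j) ({d} \<union> (U j - {w}))) - int (ncl E (P j) ({d} \<union> U j)))"
      using other[OF j False] by (rule sum_mono)
    also have "\<dots> \<le> int (ncl E (P j) {d}) - int (ncl E (P j) ({d} \<union> U j))"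
      by (rule sum_marginal_le[OF sym_E fin_P[OF j] fin_U[OF j]])
    also have "\<dots> \<le> int (card {r \<in> P j. \<not> E d r})"
      using ncl_singleton_le[OF sym_E fin_P[OF j], of d] ncl_pos[OF fin_P[OF j] P_ne[OF j], of E "{d} \<union> U j"]
      by linarith
    finally show ?thesis by linarith
  qed
  have "(\<Sum>w\<in>V - S. g w) = (\<Sum>w\<in>(\<Union>i\<in>I. U i). g w)"
    using fin_V asg free unfolding assignment_def by (intro sum.mono_neutral_right) auto
  also have "\<dots> = (\<Sum>i\<in>I. \<Sum>w\<in>U i. g w)"
    using fin_I fin_U asg unfolding assignment_def disjoint_family_on_def
    by (intro sum.UNION_disjoint) auto
  also have "\<dots> \<le> (\<Sum>i\<in>I. card {r \<in> P i. \<not> E d r})" using part by (rule sum_mono)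
  also have "\<dots> = card (\<Union>i\<in>I. {r \<in> P i. \<not> E d r})"
    using fin_I fin_P disj_P unfolding disjoint_family_on_def
    by (intro card_UN_disjoint[symmetric]) auto
  also have "(\<Union>i\<in>I. {r \<in> P i. \<not> E d r}) = {r \<in> S. \<not> E d r}" using S_eq by auto
  finally show ?thesis unfolding g_def .
qed

text \<open>Double counting the edges from representatives of three components into
  \<open>V - S\<close>: each degree exceeds half of \<open>card (V - S)\<close>, so the total gain
  does too, more than the free vertex \<open>d\<close> can miss.\<close>

lemma ncl_le_2:
  assumes i0: "i0 \<in> I"
  shows "ncl E (P i0) (U i0) \<le> 2"
proof (rule ccontr)
  assume "\<not> ?thesis"
  then have "3 \<le> card (cl E (P i0) (U i0) ` P i0)" by (simp add: ncl_def)
  then obtain \<T> where T: "\<T> \<subseteq> cl E (P i0) (U i0) ` P i0" "card \<T> = 3"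
    by (meson obtain_subset_with_card_n)
  let ?cl = "cl E (P i0) (U i0)"
  obtain N where N: "N \<subseteq> P i0" "inj_on ?cl N" "\<T> = ?cl ` N" using T(1) by (metis subset_image_inj)
  have cN: "card N = 3" using T(2) N by (simp add: card_image)
  have finN: "finite N" using N(1) fin_P[OF i0] finite_subset by auto
  have NS: "N \<subseteq> S" using N(1) i0 S_eq by auto
  have nonadj: "\<not> E x v" if "x \<in> N" "v \<in> N" for x v
  proof
    assume e: "E x v"
    have xP: "x \<in> P i0" "v \<in> P i0" using that N by auto
    have "v \<in> ?cl x"
      using closed_in_cl[OF xP(1), of E "U i0"] cl_self[of x E "P i0" "U i0"] e xP
      unfolding closed_in_def by blast
    then have "?cl v = ?cl x" by (rule cl_eq[OF sym_E xP(1)])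
    then have "v = x" using N(2) that by (auto dest: inj_onD)
    then show False using e irrefl_E by auto
  qed
  let ?g = "\<lambda>w. card (touched E (P i0) (U i0) w) - 1"
  have "3 * (card (V - S) + 4) = (\<Sum>x\<in>N. card (V - S) + 4)" using cN by simp
  also have "\<dots> \<le> (\<Sum>x\<in>N. 2 * deg E x (V - S))"
    using deg_outside_ge[OF _ NS cN] nonadj NS by (intro sum_mono) auto
  also have "\<dots> = 2 * (\<Sum>x\<in>N. \<Sum>w\<in>V - S. of_bool (E x w))"
    using fin_V deg_sum[of "V - S" E] by (simp add: sum_distrib_left del: sum_of_bool_eq)
  also have "(\<Sum>x\<in>N. \<Sum>w\<in>V - S. of_bool (E x w)) = (\<Sum>w\<in>V - S. \<Sum>x\<in>N. of_bool (E x w) :: nat)"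
    by (rule sum.swap)
  also have "\<dots> \<le> (\<Sum>w\<in>V - S. 1 + ?g w)"
  proof (rule sum_mono)
    fix w assume "w \<in> V - S"
    have "(\<Sum>x\<in>N. of_bool (E x w)) = card {x \<in> N. E x w}" using card_filter_sum[OF finN] by simp
    \<comment> \<open>Distinct representatives adjacent to \<open>w\<close> lie in distinct touched
      components.\<close>
    also have "\<dots> = card (?cl ` {x \<in> N. E x w})"
      using N(2) by (intro card_image[symmetric]) (auto intro: inj_on_subset)
    also have "\<dots> \<le> card (touched E (P i0) (U i0) w)"
      using N(1) E_sym fin_P[OF i0] by (intro card_mono) (auto simp: touched_def)
    finally show "(\<Sum>x\<in>N. of_bool (E x w)) \<le> 1 + ?g w" by linarith
  qed
  also have "(\<Sum>w\<in>V - S. 1 + ?g w) = card (V - S) + (\<Sum>w\<in>V - S. ?g w)"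
    unfolding sum.distrib by simp
  finally have low: "3 * (card (V - S) + 4) \<le> 2 * (card (V - S) + (\<Sum>w\<in>V - S. ?g w))" by simp
  obtain d where d: "d \<in> V - S" "\<forall>i\<in>I. d \<notin> U i" using exists_unassigned i0 by blast
  have "(\<Sum>w\<in>V - S. ?g w) \<le> card {r \<in> S. \<not> E d r}" by (rule sum_gain_le[OF i0 d])
  then have "2 * (\<Sum>w\<in>V - S. ?g w) \<le> card (V - S)" using card_missed_le[OF d(1)] by simp
  then show False using low by simp
qed

section \<open>From a cheapest assignment to a system of blocks\<close>

definition attach :: "'i \<Rightarrow> 'a set \<Rightarrow> 'a set" where
  "attach i C = C \<union> {w \<in> U i. \<exists>r\<in>C. E w r}"

text \<open>A subset \<open>Q\<close> without outgoing edges meets \<open>C\<close>, as attached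
  vertices have neighbours there. It meets \<open>C\<close> in a closed set, so it contains
  \<open>C\<close> and then every attached vertex.\<close>

lemma conn_attach:
  assumes i: "i \<in> I" and u: "u \<in> P i" and C: "C = cl E (P i) (U i) u"
  shows "conn E (attach i C)"
  unfolding conn_def
proof (intro conjI allI impI)
  have uC: "u \<in> C" unfolding C by (rule cl_self)
  then show "attach i C \<noteq> {}" by (auto simp: attach_def)
  fix Q assume Q: "Q \<subseteq> attach i C" "Q \<noteq> {} \<and> Q \<noteq> attach i C"
  have cC: "closed_in E (P i) (U i) C" unfolding C by (rule closed_in_cl[OF u])
  then have CP: "C \<subseteq> P i" by (simp add: closed_in_def)
  show "\<exists>q\<in>Q. \<exists>r\<in>attach i C - Q. E q r"
  proof (rule ccontr)
    assume "\<not> ?thesis"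
    then have stay: "r \<in> Q" if "q \<in> Q" "r \<in> attach i C" "E q r" for q r using that by blast
    have "closed_in E (P i) (U i) (C \<inter> Q)"
      unfolding closed_in_def
    proof (intro conjI ballI impI)
      show "C \<inter> Q \<subseteq> P i" using CP by auto
      fix p v assume p: "p \<in> C \<inter> Q" and v: "v \<in> P i"
      show "v \<in> C \<inter> Q" if "E p v"
      proof -
        have "v \<in> C" using cC p v that unfolding closed_in_def by blast
        then show ?thesis using stay[of p v] p that by (auto simp: attach_def)
      qed
      fix w assume w: "w \<in> U i" "E w p \<and> E w v"
      have vC: "v \<in> C" using cC p v w unfolding closed_in_def by blast
      have "w \<in> attach i C" using w p by (auto simp: attach_def)
      then have "w \<in> Q" using stay[of p w] p w E_sym by blast
      then show "v \<in> C \<inter> Q" using stay[of w v] vC w by (auto simp: attach_def)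
    qed
    then have all: "C \<subseteq> Q" if "C \<inter> Q \<noteq> {}"
    proof -
      obtain p where p: "p \<in> C \<inter> Q" using \<open>C \<inter> Q \<noteq> {}\<close> by auto
      have "cl E (P i) (U i) p \<subseteq> C \<inter> Q" by (rule cl_least) fact+
      moreover have "cl E (P i) (U i) p = C" unfolding C by (rule cl_eq[OF sym_E u]) (use p C in auto)
      ultimately show ?thesis by auto
    qed
    have meet: "C \<inter> Q \<noteq> {}"
    proof
      assume e: "C \<inter> Q = {}"
      obtain w where "w \<in> Q" using Q by auto
      then have "w \<in> Q" "w \<in> U i" "\<exists>r\<in>C. E w r" using Q(1) e by (auto simp: attach_def)
      then show False using stay e by (auto simp: attach_def)
    qed
    have "w \<in> Q" if "w \<in> U i" "r \<in> C" "E w r" for w r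
      using stay[of r w] all[OF meet] that E_sym by (auto simp: attach_def)
    then have "attach i C \<subseteq> Q"
      using all[OF meet] by (auto simp: attach_def)
    then show False using Q by auto
  qed
qed

lemma blocks_of_assignment: "blocks (\<Union>i\<in>I. attach i ` cl E (P i) (U i) ` P i)"
proof -
  let ?B = "\<Union>i\<in>I. attach i ` cl E (P i) (U i) ` P i"
  have clP: "cl E (P i) (U i) u \<subseteq> P i" if "u \<in> P i" for i u
    using closed_in_cl[OF that] by (auto simp: closed_in_def)
  have US: "U i \<subseteq> V - S" if "i \<in> I" for i using asg that by (auto simp: assignment_def)
  have PS: "P i \<subseteq> S" if "i \<in> I" for i using that S_eq by auto
  have repr: "\<exists>i\<in>I. \<exists>u\<in>P i. K = attach i (cl E (P i) (U i) u)" if "K \<in> ?B" for K using that by auto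
  have interS: "attach i (cl E (P i) (U i) u) \<inter> S = cl E (P i) (U i) u" if "i \<in> I" "u \<in> P i" for i u
    using US[OF that(1)] PS[OF that(1)] clP[OF that(2)] by (auto simp: attach_def)
  have "?B \<subseteq> Pow V"
  proof
    fix K assume "K \<in> ?B"
    then obtain i u where iu: "i \<in> I" "u \<in> P i" "K = attach i (cl E (P i) (U i) u)" using repr by blast
    then show "K \<in> Pow V" using clP[OF iu(2)] US[OF iu(1)] PS[OF iu(1)] S_sub by (auto simp: attach_def)
  qed
  moreover have "\<forall>K\<in>?B. conn E K \<and> (\<exists>i\<in>I. K \<inter> S \<noteq> {} \<and> K \<inter> S \<subseteq> P i)"
  proof
    fix K assume "K \<in> ?B"
    then obtain i u where iu: "i \<in> I" "u \<in> P i" "K = attach i (cl E (P i) (U i) u)" using repr by blast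
    have "conn E K" unfolding iu(3) by (rule conn_attach[OF iu(1,2) refl])
    moreover have "K \<inter> S \<noteq> {}" "K \<inter> S \<subseteq> P i"
      unfolding iu(3) interS[OF iu(1,2)] using cl_self[of u E "P i" "U i"] clP[OF iu(2)] by auto
    ultimately show "conn E K \<and> (\<exists>i\<in>I. K \<inter> S \<noteq> {} \<and> K \<inter> S \<subseteq> P i)" using iu(1) by blast
  qed
  moreover have "disjoint ?B" unfolding disjoint_def
  proof (intro ballI impI)
    fix K L assume "K \<in> ?B" "L \<in> ?B" and ne: "K \<noteq> L"
    obtain i u where iu: "i \<in> I" "u \<in> P i" "K = attach i (cl E (P i) (U i) u)"
      using repr[OF \<open>K \<in> ?B\<close>] by blast
    obtain j v where jv: "j \<in> I" "v \<in> P j" "L = attach j (cl E (P j) (U j) v)"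
      using repr[OF \<open>L \<in> ?B\<close>] by blast
    show "K \<inter> L = {}"
    proof (rule ccontr)
      assume "K \<inter> L \<noteq> {}"
      then obtain z where z: "z \<in> K" "z \<in> L" by auto
      have "i = j \<and> cl E (P i) (U i) u = cl E (P j) (U j) v"
      proof (cases "z \<in> S")
        case True
        then have zc: "z \<in> cl E (P i) (U i) u" "z \<in> cl E (P j) (U j) v"
          using z interS[OF iu(1,2)] interS[OF jv(1,2)] iu jv by auto
        then have ij: "i = j" using clP iu jv P_index_unique[of i j z] by blast
        then show ?thesis using cl_eq[OF sym_E iu(2) zc(1)] cl_eq[OF sym_E jv(2) zc(2)] by simp
      next
        case False
        \<comment> \<open>An assigned vertex ties all its neighbours in the part together, so the
          two components it is attached to coincide.\<close>
        then have zi: "z \<in> U i" "z \<in> U j"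
          using z iu jv clP[OF iu(2)] clP[OF jv(2)] PS by (auto simp: attach_def)
        then have ij: "i = j" using asg iu(1) jv(1) unfolding assignment_def disjoint_family_on_def by blast
        have vP: "v \<in> P i" using jv ij by simp
        have "z \<notin> cl E (P i) (U i) u" "z \<notin> cl E (P i) (U i) v"
          using False clP[OF iu(2)] clP[OF vP] PS[OF iu(1)] by auto
        then obtain r s where rs: "r \<in> cl E (P i) (U i) u" "E z r" "s \<in> cl E (P i) (U i) v" "E z s"
          using z iu(3) jv(3) ij unfolding attach_def by blast
        have "s \<in> cl E (P i) (U i) u"
          using closed_in_cl[OF iu(2), of E "U i"] rs zi clP[OF vP] unfolding closed_in_def by blast
        then show ?thesis using cl_eq[OF sym_E iu(2), of s] cl_eq[OF sym_E vP rs(3)] ij by simp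
      qed
      then show False using ne iu(3) jv(3) by metis
    qed
  qed
  moreover have "S \<subseteq> \<Union>?B"
  proof
    fix u assume "u \<in> S"
    then obtain i where i: "i \<in> I" "u \<in> P i" using S_eq by auto
    have "u \<in> attach i (cl E (P i) (U i) u)" using cl_self[of u] by (auto simp: attach_def)
    then show "u \<in> \<Union>?B" using i by blast
  qed
  moreover have "card (\<Union>?B - S) + 2 * card ?B \<le> card S + 2 * card I"
  proof -
    have "\<Union>?B - S \<subseteq> (\<Union>i\<in>I. U i)" using clP PS by (fastforce simp: attach_def)
    then have "card (\<Union>?B - S) \<le> card (\<Union>i\<in>I. U i)" using fin_I fin_U by (intro card_mono) auto
    also have "\<dots> \<le> (\<Sum>i\<in>I. card (U i))" using fin_I by (rule card_UN_le)
    finally have 1: "card (\<Union>?B - S) \<le> (\<Sum>i\<in>I. card (U i))" .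
    have "card ?B \<le> (\<Sum>i\<in>I. card (attach i ` cl E (P i) (U i) ` P i))" using fin_I by (rule card_UN_le)
    also have "\<dots> \<le> (\<Sum>i\<in>I. ncl E (P i) (U i))"
      unfolding ncl_def using fin_P by (intro sum_mono card_image_le) auto
    finally have 2: "card ?B \<le> (\<Sum>i\<in>I. ncl E (P i) (U i))" .
    have "(\<Sum>i\<in>I. ncl E (P i) (U i)) \<le> (\<Sum>i\<in>I. 2)" using ncl_le_2 by (rule sum_mono)
    then have 3: "(\<Sum>i\<in>I. ncl E (P i) (U i)) \<le> 2 * card I" by simp
    \<comment> \<open>Of the two copies of the component count, one is absorbed by
      \<open>sum_card_U_le\<close> and the other is at most \<open>2 * card I\<close>.\<close>
    show ?thesis using 1 2 3 sum_card_U_le by linarith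
  qed
  ultimately show ?thesis unfolding blocks_def by blast
qed

end

lemma linkage: "\<exists>C. (\<forall>i\<in>I. P i \<subseteq> C i \<and> C i \<subseteq> V \<and> conn E (C i)) \<and> disjoint_family_on C I"
proof -
  have "assignment (\<lambda>_. {})" by (simp add: assignment_def disjoint_family_on_def)
  then obtain U where "assignment U" "\<And>U'. assignment U' \<Longrightarrow> cost U \<le> cost U'"
    using ex_has_least_nat[of assignment "\<lambda>_. {}" cost] by blast
  then show ?thesis using linkage_if_blocks blocks_of_assignment by blast
qed

end

section \<open>The degree condition and its sharpness\<close>

lemma out_degree_eq_deg:
  "out_degree (with_proj G) v = card {u. (v, u) \<in> parcs G}"
proof -
  have "out_arcs (with_proj G) v = Pair v ` {u. (v, u) \<in> parcs G}"
    by (auto simp: out_arcs_def)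
  then show ?thesis unfolding out_degree_def by (simp add: card_image inj_on_def)
qed

lemma pair_graph_induced:
  assumes "pair_graph G" "X \<subseteq> pverts G"
  defines "H \<equiv> \<lparr>pverts = X, parcs = {e \<in> parcs G. fst e \<in> X \<and> snd e \<in> X}\<rparr>"
  shows "pair_graph H" "subgraph (with_proj H) (with_proj G)"
proof -
  interpret G: pair_graph G by fact
  have symG: "(u, v) \<in> parcs G \<Longrightarrow> (v, u) \<in> parcs G" for u v
    using G.sym_arcs by (auto simp: symmetric_def sym_def)
  show "pair_graph H"
  proof unfold_locales
    show "finite (pverts H)" using finite_subset[OF assms(2) G.finite_verts] by (simp add: H_def)
    show "finite (parcs H)" using G.finite_arcs by (auto simp: H_def)
    show "symmetric (with_proj H)" unfolding symmetric_def sym_def using symG by (auto simp: H_def)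
    show "\<And>e. e \<in> parcs H \<Longrightarrow> fst e \<noteq> snd e" using G.no_loops by (auto simp: H_def)
  qed (auto simp: H_def)
  then interpret H: pair_graph H .
  show "subgraph (with_proj H) (with_proj G)"
    unfolding subgraph_def compatible_def
    using assms(2) G.wf_digraph H.wf_digraph by (auto simp: H_def)
qed

text \<open>No edge leaves the set of vertices reachable from \<open>u\<close>, so by the cut
  condition it is everything.\<close>

lemma connected_if_conn:
  assumes "pair_wf_digraph H" "conn (\<lambda>u v. (u, v) \<in> parcs H) (pverts H)"
  shows "Digraph_Component.connected (with_proj H)"
proof -
  interpret H: pair_wf_digraph H by fact
  interpret M: pair_wf_digraph "mk_symmetric (with_proj H)" ..
  let ?M = "with_proj (mk_symmetric (with_proj H))"
  have "v \<in> {v \<in> pverts H. u \<rightarrow>\<^sup>*\<^bsub>?M\<^esub> v}" if uv: "u \<in> pverts H" "v \<in> pverts H" for u v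
  proof (rule ccontr)
    let ?Q = "{v \<in> pverts H. u \<rightarrow>\<^sup>*\<^bsub>?M\<^esub> v}"
    assume "v \<notin> ?Q"
    moreover have "u \<in> ?Q" using uv by auto
    ultimately obtain q r where qr: "q \<in> ?Q" "r \<in> pverts H - ?Q" "(q, r) \<in> parcs H"
      using connE[OF assms(2), of ?Q] uv by blast
    have "u \<rightarrow>\<^sup>*\<^bsub>?M\<^esub> q" using qr(1) by simp
    moreover have "(q, r) \<in> parcs (mk_symmetric (with_proj H))" using qr(3) by (force simp: parcs_mk_symmetric)
    ultimately have "u \<rightarrow>\<^sup>*\<^bsub>?M\<^esub> r" by (rule M.reachable_adj_trans)
    then show False using qr(2) by auto
  qed
  moreover have "pverts H \<noteq> {}" using assms(2) by (simp add: conn_def)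
  ultimately show ?thesis unfolding connected_def strongly_connected_def by auto
qed

lemma knitted_if_min_degree:
  assumes G: "pair_graph G" and card_G: "card (pverts G) = n" and n: "n \<ge> 2 * k" "n > 0"
    and deg_G: "real (min_degree G) \<ge> (real n + real k) / 2 - 1"
  shows "knitted k G"
  unfolding knitted_def
proof (intro conjI allI impI)
  interpret G: pair_graph G by fact
  show "k \<le> card (pverts G)" using card_G n by simp
  fix S and t :: nat and P
  assume A: "S \<subseteq> pverts G \<and> card S = k \<and> 1 \<le> t \<and> (\<Union>i\<in>{1..t}. P i) = S \<and>
    disjoint_family_on P {1..t} \<and> (\<forall>i\<in>{1..t}. P i \<noteq> {})"
  define E where "E u v \<longleftrightarrow> (u, v) \<in> parcs G" for u v
  have fin: "finite (pverts G)" by (rule G.finite_verts)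
  have sym: "symp E" using G.sym_arcs by (auto simp: symmetric_def sym_def symp_def E_def)
  have irr: "\<not> E v v" for v using G.no_loops' by (auto simp: E_def)
  have deg: "card (pverts G) + card S \<le> 2 * deg E v (pverts G) + 2" if v: "v \<in> pverts G" for v
  proof -
    have "{u \<in> pverts G. E v u} = {u. (v, u) \<in> parcs G}" using G.in_arcsD2 by (auto simp: E_def)
    then have "deg E v (pverts G) = out_degree (with_proj G) v"
      by (simp add: deg_def out_degree_eq_deg)
    moreover have "min_degree G \<le> out_degree (with_proj G) v"
      unfolding min_degree_def using fin v by (intro Min_le) auto
    ultimately have "real (deg E v (pverts G)) \<ge> (real n + real k) / 2 - 1" using deg_G by simp
    then show ?thesis using card_G A by (simp add: field_simps)
  qed
  interpret partitioned_graph "pverts G" E S "{1..t}" P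
    by unfold_locales (use A fin sym deg card_G n irr in auto)
  obtain C where C: "\<forall>i\<in>{1..t}. P i \<subseteq> C i \<and> C i \<subseteq> pverts G \<and> conn E (C i)" "disjoint_family_on C {1..t}"
    using linkage by blast
  define H where "H i = \<lparr>pverts = C i, parcs = {e \<in> parcs G. fst e \<in> C i \<and> snd e \<in> C i}\<rparr>" for i
  have "pair_graph (H i) \<and> subgraph (with_proj (H i)) (with_proj G) \<and>
      Digraph_Component.connected (with_proj (H i)) \<and> P i \<subseteq> pverts (H i)" if i: "i \<in> {1..t}" for i
  proof -
    have Ci: "P i \<subseteq> C i" "C i \<subseteq> pverts G" "conn E (C i)" using C i by auto
    note ind = pair_graph_induced[OF G Ci(2), folded H_def]
    interpret H: pair_graph "H i" by (rule ind(1))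
    have "conn (\<lambda>u v. (u, v) \<in> parcs (H i)) (pverts (H i))"
      unfolding conn_def
    proof (intro conjI allI impI)
      show "pverts (H i) \<noteq> {}" using Ci(3) by (simp add: conn_def H_def)
      fix Q assume Q: "Q \<subseteq> pverts (H i)" "Q \<noteq> {} \<and> Q \<noteq> pverts (H i)"
      obtain q r where "q \<in> Q" "r \<in> C i - Q" "E q r"
        by (rule connE[OF Ci(3), of Q]) (use Q in \<open>auto simp: H_def\<close>)
      then show "\<exists>q\<in>Q. \<exists>r\<in>pverts (H i) - Q. (q, r) \<in> parcs (H i)"
        using Q(1) by (intro bexI[of _ q] bexI[of _ r]) (auto simp: H_def E_def)
    qed
    then have "Digraph_Component.connected (with_proj (H i))"
      by (rule connected_if_conn[OF H.pair_wf_digraph])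
    then show ?thesis using ind Ci(1) by (simp add: H_def)
  qed
  moreover have "disjoint_family_on (\<lambda>i. pverts (H i)) {1..t}" using C(2) by (simp add: H_def)
  ultimately show "\<exists>C. (\<forall>i\<in>{1..t}. pair_graph (C i) \<and> subgraph (with_proj (C i)) (with_proj G) \<and>
      Digraph_Component.connected (with_proj (C i)) \<and> P i \<subseteq> pverts (C i)) \<and>
      disjoint_family_on (\<lambda>i. pverts (C i)) {1..t}" by blast
qed

section \<open>The extremal graph: two overlapping cliques\<close>

definition overlapping_cliques :: "nat \<Rightarrow> nat \<Rightarrow> nat \<Rightarrow> nat pair_pre_digraph" where
  "overlapping_cliques m p n = \<lparr>pverts = {..<n},
     parcs = {(u, v). u < n \<and> v < n \<and> u \<noteq> v \<and> (u < p \<and> v < p \<or> m \<le> u \<and> m \<le> v)}\<rparr>"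

lemma pair_graph_overlapping_cliques: "pair_graph (overlapping_cliques m p n)" (is "pair_graph ?H")
proof unfold_locales
  show "finite (parcs ?H)"
    by (rule finite_subset[of _ "{..<n} \<times> {..<n}"]) (auto simp: overlapping_cliques_def)
  show "symmetric (with_proj ?H)" by (auto simp: symmetric_def sym_def overlapping_cliques_def)
qed (auto simp: overlapping_cliques_def)

text \<open>Vertices of the overlap see all others, so the minimum is attained outside it, at
  \<open>0\<close> or at \<open>n - 1\<close>.\<close>

lemma min_degree_overlapping_cliques:
  assumes "0 < m" "m \<le> p" "p < n"
  shows "min_degree (overlapping_cliques m p n) = min (p - 1) (n - m - 1)"
proof -
  let ?H = "overlapping_cliques m p n" and ?N = "\<lambda>v. {u. (v, u) \<in> parcs (overlapping_cliques m p n)}"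
  have left: "card (?N v) = p - 1" if "v < m" for v
  proof -
    have "?N v = {..<p} - {v}" using assms that by (auto simp: overlapping_cliques_def)
    then show ?thesis using assms that by simp
  qed
  have right: "card (?N v) = n - m - 1" if "p \<le> v" "v < n" for v
  proof -
    have "?N v = {m..<n} - {v}" using assms that by (auto simp: overlapping_cliques_def)
    then show ?thesis using assms that by simp
  qed
  have mid: "card (?N v) = n - 1" if "m \<le> v" "v < p" for v
  proof -
    have "?N v = {..<n} - {v}" using assms that by (auto simp: overlapping_cliques_def)
    then show ?thesis using assms that by simp
  qed
  show ?thesis unfolding min_degree_def
  proof (rule Min_eqI)
    show "finite (out_degree (with_proj ?H) ` pverts ?H)" by (simp add: overlapping_cliques_def)
    fix y assume "y \<in> out_degree (with_proj ?H) ` pverts ?H"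
    then obtain v where v: "v < n" "y = card (?N v)" by (auto simp: overlapping_cliques_def out_degree_eq_deg)
    consider "v < m" | "m \<le> v" "v < p" | "p \<le> v" by linarith
    then show "min (p - 1) (n - m - 1) \<le> y"
      by cases (use v left right mid assms in auto)
  next
    have "out_degree (with_proj ?H) 0 = p - 1" using left assms by (simp add: out_degree_eq_deg)
    moreover have "out_degree (with_proj ?H) (n - 1) = n - m - 1" using right[of "n - 1"] assms by (simp add: out_degree_eq_deg)
    moreover have "0 \<in> pverts ?H" "n - 1 \<in> pverts ?H" using assms by (auto simp: overlapping_cliques_def)
    ultimately show "min (p - 1) (n - m - 1) \<in> out_degree (with_proj ?H) ` pverts ?H"
      by (metis image_eqI min_def)
  qed
qed

text \<open>Partition the overlap into singletons and join the two remaining parts of the cliques by one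
  pair: the singletons block every path between its two vertices.\<close>

lemma not_knitted_overlapping_cliques:
  assumes "0 < m" "m \<le> p" "p < n"
  shows "\<not> knitted (p - m + 2) (overlapping_cliques m p n)"
proof
  let ?H = "overlapping_cliques m p n"
  assume kn: "knitted (p - m + 2) ?H"
  define t where "t = p - m + 1"
  \<comment> \<open>The \<open>p - m\<close> overlap vertices are numbered from 1, hence the shift
    \<open>m + i - 1\<close>; the last index carries the pair.\<close>
  define P where "P i = (if i = t then {0, n - 1} else {m + i - 1})" for i
  define S where "S = {m..<p} \<union> {0, n - 1}"
  have "S \<subseteq> pverts ?H" using assms by (auto simp: S_def overlapping_cliques_def)
  moreover have "card S = p - m + 2"
  proof -
    have "card S = card {m..<p} + card {0, n - 1}"
      unfolding S_def using assms by (intro card_Un_disjoint) auto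
    then show ?thesis using assms by simp
  qed
  moreover have "(\<Union>i\<in>{1..t}. P i) = S"
  proof -
    have "{1..t} = insert t {1..<t}" by (auto simp: t_def)
    then have "(\<Union>i\<in>{1..t}. P i) = P t \<union> (\<Union>i\<in>{1..<t}. P i)" by simp
    also have "(\<Union>i\<in>{1..<t}. P i) = (\<lambda>i. m + i - 1) ` {1..<t}" by (auto simp: P_def)
    also have "\<dots> = {m..<p}"
    proof (intro equalityI subsetI)
      fix x assume "x \<in> {m..<p}"
      then have "x = m + (x - m + 1) - 1" "x - m + 1 \<in> {1..<t}" by (auto simp: t_def)
      then show "x \<in> (\<lambda>i. m + i - 1) ` {1..<t}" by blast
    qed (auto simp: t_def)
    finally show ?thesis by (auto simp: P_def S_def)
  qed
  moreover have "disjoint_family_on P {1..t}" "\<forall>i\<in>{1..t}. P i \<noteq> {}"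
    using assms by (auto simp: disjoint_family_on_def P_def t_def)
  moreover have "1 \<le> t" by (simp add: t_def)
  ultimately obtain C where C: "\<forall>i\<in>{1..t}. pair_graph (C i) \<and> subgraph (with_proj (C i)) (with_proj ?H) \<and>
      Digraph_Component.connected (with_proj (C i)) \<and> P i \<subseteq> pverts (C i)"
    and dis: "disjoint_family_on (\<lambda>i. pverts (C i)) {1..t}"
    using kn unfolding knitted_def by metis
  have t: "t \<in> {1..t}" by (simp add: t_def)
  have avoid: "x \<notin> pverts (C t)" if "x \<in> {m..<p}" for x
  proof -
    define i where "i = x - m + 1"
    have i: "i \<in> {1..t}" "i \<noteq> t" "P i = {x}" using that by (auto simp: i_def t_def P_def)
    then have "x \<in> pverts (C i)" using C by blast
    then show ?thesis using dis i t unfolding disjoint_family_on_def by blast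
  qed
  have sub: "parcs (C t) \<subseteq> parcs ?H" using C t by (auto simp: subgraph_def)
  have con: "Digraph_Component.connected (with_proj (C t))" and P: "P t \<subseteq> pverts (C t)" and wf: "pair_graph (C t)"
    using C t by auto
  interpret Ct: pair_graph "C t" by (rule wf)
  interpret M: pair_wf_digraph "mk_symmetric (with_proj (C t))" ..
  let ?M = "with_proj (mk_symmetric (with_proj (C t)))"
  have "0 \<rightarrow>\<^sup>*\<^bsub>?M\<^esub> (n - 1)"
    using con P unfolding connected_def strongly_connected_def by (auto simp: P_def)
  \<comment> \<open>Everything reached from \<open>0\<close> stays below \<open>m\<close>: no arc
    leads from there to a vertex from \<open>p\<close> on, and \<open>avoid\<close> excludes the
    overlap.\<close>
  then have "n - 1 < m"
  proof (induction rule: M.reachable_induct)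
    case base
    then show ?case using assms by simp
  next
    case (step x y)
    have "(x, y) \<in> parcs (C t) \<or> (y, x) \<in> parcs (C t)"
      using step.hyps(2) by (auto simp: parcs_mk_symmetric)
    then have "(x, y) \<in> parcs ?H \<or> (y, x) \<in> parcs ?H" "y \<in> pverts (C t)"
      using sub Ct.in_arcsD1 Ct.in_arcsD2 by auto
    then show ?case using step.IH avoid[of y] by (cases "m \<le> y") (auto simp: overlapping_cliques_def)
  qed
  then show False using assms by simp
qed

theorem theorem2:
  shows "(\<forall>(k::nat) (n::nat) (G :: 'a pair_pre_digraph).
            k \<ge> 5 \<and> pair_graph G \<and> card (pverts G) = n \<and> n \<ge> 2 * k + 3 \<and>
            real (min_degree G) \<ge> (real n + real k) / 2 - 1
            \<longrightarrow> knitted k G)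
       \<and> (\<forall>(k::nat) (n::nat).
            k \<ge> 5 \<and> n \<ge> 2 * k + 3 \<longrightarrow>
            (\<exists>H :: nat pair_pre_digraph.
               pair_graph H \<and> card (pverts H) = n \<and>
               int (min_degree H) = \<lfloor>(real n + real k) / 2\<rfloor> - 2 \<and>
               \<not> knitted k H))"
proof (intro conjI allI impI)
  fix k n :: nat and G :: "'a pair_pre_digraph"
  assume "k \<ge> 5 \<and> pair_graph G \<and> card (pverts G) = n \<and> n \<ge> 2 * k + 3 \<and>
            real (min_degree G) \<ge> (real n + real k) / 2 - 1"
  then show "knitted k G" by (intro knitted_if_min_degree[of G n]) auto
next
  fix k n :: nat
  assume kn: "k \<ge> 5 \<and> n \<ge> 2 * k + 3"
  \<comment> \<open>The cliques get sizes \<open>p\<close> and \<open>n - m\<close>, the floor and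
    the ceiling of \<open>(n + k) / 2 - 1\<close>, with \<open>k - 2\<close> common vertices; the
    smaller clique gives the minimum degree.\<close>
  define p where "p = (n + k) div 2 - 1"
  define m where "m = p + 2 - k"
  have mp: "0 < m" "m \<le> p" "p < n" "p - m + 2 = k" using kn by (auto simp: p_def m_def)
  have "min (p - 1) (n - m - 1) = (n + k) div 2 - 2" using kn by (auto simp: p_def m_def)
  moreover have "(n + k) div 2 \<ge> 2" using kn by linarith
  ultimately have "int (min_degree (overlapping_cliques m p n)) = int ((n + k) div 2) - 2"
    using min_degree_overlapping_cliques[OF mp(1-3)] by (simp add: of_nat_diff)
  also have "int ((n + k) div 2) = \<lfloor>(real n + real k) / 2\<rfloor>"
    using floor_divide_of_nat_eq[of "n + k" 2, where 'a = real] by simp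
  finally have "int (min_degree (overlapping_cliques m p n)) = \<lfloor>(real n + real k) / 2\<rfloor> - 2" .
  moreover have "card (pverts (overlapping_cliques m p n)) = n" by (simp add: overlapping_cliques_def)
  ultimately show "\<exists>H :: nat pair_pre_digraph. pair_graph H \<and> card (pverts H) = n \<and>
      int (min_degree H) = \<lfloor>(real n + real k) / 2\<rfloor> - 2 \<and> \<not> knitted k H"
    using pair_graph_overlapping_cliques not_knitted_overlapping_cliques[OF mp(1-3)] mp(4) by blast
qed

end
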